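(* Let $G$ and $H$ be finite abelian groups, let $V$ be the regular representation of $G$ over $\mathbb C$ and $V'$ the regular representation of $H$ over $\mathbb C$. Then $\dim \mathbb C[V]^G_{|H|}=\dim \mathbb C[V']^H_{|G|}$ if and only if $\varphi_G(d)=\varphi_H(d)$ for every positive integer $d$ dividing $\gcd(|G|,|H|)$.
   Context: For a finite group $G$ and a finite-dimensional complex representation $V$ of $G$, $\mathbb C[V]$ is the graded algebra of polynomial functions on $V$ (the symmetric algebra on $V^*$), with the action of $G$ induced by $f^g(v)=f(g\cdot v)$; $\mathbb C[V]^G$ is the subalgebra of $G$-invariant polynomials and $\mathbb C[V]^G_m$ its homogeneous component of degree $m$, viewed as a complex vector space. $\varphi_G(d)$ denotes the number of elements of $G$ of order exactly $d$. *)

theory Defs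
  imports Complex_Main "HOL-Algebra.Algebra" "HOL-Library.Function_Algebras"
begin

text \<open>
  The type \<open>'b \<Rightarrow> complex\<close> carries pointwise addition from \<open>Function_Algebras\<close>; with the scalar
  multiplication below it is a complex vector space. It is used both for vectors (with
  \<open>'b\<close> the type of group elements) and for complex-valued functions on a vector space.
\<close>

definition cscale :: "complex \<Rightarrow> ('b \<Rightarrow> complex) \<Rightarrow> ('b \<Rightarrow> complex)" where
  "cscale c f = (\<lambda>x. c * f x)"

interpretation cfun: vector_space "cscale :: complex \<Rightarrow> ('b \<Rightarrow> complex) \<Rightarrow> ('b \<Rightarrow> complex)"
  by unfold_locales (simp_all add: cscale_def fun_eq_iff algebra_simps)

text \<open>
  In what follows \<open>V\<close> is a linear subspace of \<open>'b \<Rightarrow> complex\<close>. A function on \<open>V\<close> is represented by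
  its extension by zero to the whole type, so that functions on \<open>V\<close> form a vector space
  and are equal iff they agree on \<open>V\<close>.
\<close>

definition dual_space :: "('b \<Rightarrow> complex) set \<Rightarrow> (('b \<Rightarrow> complex) \<Rightarrow> complex) set" where
  "dual_space V = {l. (\<forall>x\<in>V. \<forall>y\<in>V. l (x + y) = l x + l y) \<and>
                      (\<forall>c. \<forall>x\<in>V. l (cscale c x) = c * l x) \<and>
                      (\<forall>x. x \<notin> V \<longrightarrow> l x = 0)}"

text \<open>
  Products of \<open>m\<close> linear forms on \<open>V\<close>; they span the image of the \<open>m\<close>-th symmetric power of the dual
  space. For \<open>m = 0\<close> the only such product is the constant function one on \<open>V\<close>.
\<close>

definition linear_form_products ::
    "('b \<Rightarrow> complex) set \<Rightarrow> nat \<Rightarrow> (('b \<Rightarrow> complex) \<Rightarrow> complex) set" where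
  "linear_form_products V m =
     {(\<lambda>x. if x \<in> V then \<Prod>i<m. l i x else 0) | l :: nat \<Rightarrow> ('b \<Rightarrow> complex) \<Rightarrow> complex.
        \<forall>i<m. l i \<in> dual_space V}"

definition homogeneous_polys ::
    "('b \<Rightarrow> complex) set \<Rightarrow> nat \<Rightarrow> (('b \<Rightarrow> complex) \<Rightarrow> complex) set" where
  "homogeneous_polys V m = cfun.span (linear_form_products V m)"

definition poly_functions :: "('b \<Rightarrow> complex) set \<Rightarrow> (('b \<Rightarrow> complex) \<Rightarrow> complex) set" where
  "poly_functions V = cfun.span (\<Union>m. linear_form_products V m)"

definition invariant_polys ::
    "('a, 'm) monoid_scheme \<Rightarrow> ('b \<Rightarrow> complex) set \<Rightarrow> ('a \<Rightarrow> ('b \<Rightarrow> complex) \<Rightarrow> ('b \<Rightarrow> complex))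
      \<Rightarrow> (('b \<Rightarrow> complex) \<Rightarrow> complex) set" where
  "invariant_polys G V \<rho> =
     {f \<in> poly_functions V. \<forall>g\<in>carrier G. \<forall>x\<in>V. f (\<rho> g x) = f x}"

definition invariant_polys_degree ::
    "('a, 'm) monoid_scheme \<Rightarrow> ('b \<Rightarrow> complex) set \<Rightarrow> ('a \<Rightarrow> ('b \<Rightarrow> complex) \<Rightarrow> ('b \<Rightarrow> complex))
      \<Rightarrow> nat \<Rightarrow> (('b \<Rightarrow> complex) \<Rightarrow> complex) set" where
  "invariant_polys_degree G V \<rho> m = invariant_polys G V \<rho> \<inter> homogeneous_polys V m"

text \<open>
  The group algebra, an element \<open>x\<close> standing for the formal sum of the \<open>x a\<close> times \<open>a\<close>. Left translation
  sends the basis element \<open>a\<close> to \<open>g \<otimes> a\<close>, hence the inverse in terms of coefficients.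
\<close>

definition regular_space :: "('a, 'm) monoid_scheme \<Rightarrow> ('a \<Rightarrow> complex) set" where
  "regular_space G = {x. \<forall>a. a \<notin> carrier G \<longrightarrow> x a = 0}"

definition regular_rep ::
    "('a, 'm) monoid_scheme \<Rightarrow> 'a \<Rightarrow> ('a \<Rightarrow> complex) \<Rightarrow> ('a \<Rightarrow> complex)" where
  "regular_rep G g x = (\<lambda>a. if a \<in> carrier G then x (inv\<^bsub>G\<^esub> g \<otimes>\<^bsub>G\<^esub> a) else 0)"

definition num_elems_of_order :: "('a, 'm) monoid_scheme \<Rightarrow> nat \<Rightarrow> nat" where
  "num_elems_of_order G d = card {x \<in> carrier G. group.ord G x = d}"

end

theory Submission
  imports Defs
begin

text \<open>
  Translation by \<open>G\<close> permutes the monomials of degree \<open>m\<close> in the coordinates of the regular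
  representation, that is, the multisets of size \<open>m\<close> over \<open>G\<close>, and the orbit sums form a basis of the
  invariants. By Burnside's lemma, with \<open>n = |G|\<close> and \<open>h = |H|\<close>, the dimension times \<open>n + h\<close> is the sum of
  \<open>\<phi>\<^sub>G(d) * w(d)\<close> over \<open>d dvd gcd n h\<close>, where \<open>w(d) = ((n + h) / d) choose (n / d)\<close> is symmetric in \<open>n\<close>
  and \<open>h\<close>. Equality of the dimensions is therefore equality of two sums with the same weights.

  Suppose \<open>\<phi>\<^sub>G\<close> and \<open>\<phi>\<^sub>H\<close> differ and let \<open>d\<close> be minimal with this property. Since both functions are
  multiplicative, \<open>d\<close> is a power of a prime \<open>p\<close>; since \<open>d\<close> divides the number of solutions of \<open>x\<^sup>d = 1\<close>,
  the gap at \<open>d\<close> is at least \<open>d\<close>. The weights decrease so quickly that the contribution \<open>d * w(d)\<close> of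
  this gap exceeds everything that elements of larger order can contribute on the other side.
\<close>

section \<open>Monomials as a basis of the homogeneous polynomials\<close>

lemma sum_fun_apply: "(\<Sum>i\<in>I. f i) x = (\<Sum>i\<in>I. f i x)"
  by (induction I rule: infinite_finite_induct) auto

text \<open>Artin's argument: if \<open>chi i\<close> and \<open>chi j\<close> differ at
  \<open>y\<close>, subtracting \<open>chi j y\<close> times the relation at \<open>x\<close> from
  the relation at \<open>mul x y\<close> cancels the term of \<open>j\<close>. The shorter relation
  has coefficients \<open>c k * (chi k y - chi j y)\<close>, and the factor at \<open>k = i\<close>
  is nonzero.\<close>

lemma distinct_characters_independent:
  fixes chi :: "'i \<Rightarrow> 'v \<Rightarrow> 'k :: idom"
  assumes "finite I"
    and "\<And>x y. x \<in> V \<Longrightarrow> y \<in> V \<Longrightarrow> mul x y \<in> V"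
    and "\<And>i x y. i \<in> I \<Longrightarrow> x \<in> V \<Longrightarrow> y \<in> V \<Longrightarrow> chi i (mul x y) = chi i x * chi i y"
    and "\<And>i. i \<in> I \<Longrightarrow> \<exists>x\<in>V. chi i x \<noteq> 0"
    and "\<And>i j. i \<in> I \<Longrightarrow> j \<in> I \<Longrightarrow> i \<noteq> j \<Longrightarrow> \<exists>x\<in>V. chi i x \<noteq> chi j x"
    and "\<And>x. x \<in> V \<Longrightarrow> (\<Sum>i\<in>I. c i * chi i x) = 0"
    and "i \<in> I"
  shows "c i = 0"
  using assms
proof (induction I arbitrary: c i rule: finite_induct)
  case empty
  then show ?case by simp
next
  case (insert j I)
  note closed = insert.prems(1) and mult = insert.prems(2) and nz = insert.prems(3)
    and dist = insert.prems(4) and rel = insert.prems(5)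
  have rel': "c j * chi j x + (\<Sum>i\<in>I. c i * chi i x) = 0" if "x \<in> V" for x
    using rel[OF that] insert.hyps by simp
  have zero: "c i = 0" if i: "i \<in> I" for i
  proof -
    have "i \<noteq> j" using i insert.hyps by auto
    then obtain y where y: "y \<in> V" "chi i y \<noteq> chi j y"
      using dist[of i j] i by auto
    have "(\<Sum>k\<in>I. (c k * (chi k y - chi j y)) * chi k x) = 0" if x: "x \<in> V" for x
    proof -
      have "(\<Sum>k\<in>I. c k * chi k (mul x y)) = (\<Sum>k\<in>I. c k * (chi k x * chi k y))"
        using mult x y by (intro sum.cong) auto
      moreover have "chi j (mul x y) = chi j x * chi j y" using mult x y by auto
      ultimately have "c j * (chi j x * chi j y) + (\<Sum>k\<in>I. c k * (chi k x * chi k y)) = 0"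
        using rel'[OF closed[OF x y(1)]] by simp
      moreover have "(c j * chi j x + (\<Sum>k\<in>I. c k * chi k x)) * chi j y = 0"
        using rel'[OF x] by simp
      ultimately show ?thesis
        by (simp add: algebra_simps sum_subtractf sum_distrib_left sum_distrib_right)
          (metis add_left_cancel)
    qed
    then have "c i * (chi i y - chi j y) = 0"
      by (intro insert.IH[of "\<lambda>k. c k * (chi k y - chi j y)" i])
        (use closed mult nz dist i in auto)
    then show ?thesis using y(2) by simp
  qed
  show ?case
  proof (cases "i = j")
    case True
    obtain x where x: "x \<in> V" "chi j x \<noteq> 0" using nz[of j] by auto
    have "c j * chi j x = 0" using rel'[OF x(1)] zero by simp
    then show ?thesis using x True by simp
  qed (use zero insert.prems in auto)
qed

text \<open>For \<open>S = carrier G\<close> this is \<open>regular_space G\<close>; a bare set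
  suffices until the group acts.\<close>

definition coord_space :: "'a set \<Rightarrow> ('a \<Rightarrow> complex) set" where
  "coord_space S = {x. \<forall>a. a \<notin> S \<longrightarrow> x a = 0}"

text \<open>The exponent of \<open>x a\<close> is the multiplicity of \<open>a\<close>. The value
  zero off \<open>coord_space S\<close> follows the convention for functions on a subspace.\<close>

definition mset_monomial :: "'a set \<Rightarrow> 'a multiset \<Rightarrow> ('a \<Rightarrow> complex) \<Rightarrow> complex" where
  "mset_monomial S A = (\<lambda>x. if x \<in> coord_space S then \<Prod>a\<in>#A. x a else 0)"

text \<open>Monomials are multiplicative for the pointwise product of vectors, so they are
  independent as soon as they are nonzero and pairwise distinct as functions.\<close>

lemma mset_monomial_independent:
  assumes "M \<subseteq> multisets_of_size S m" "finite M"
    and "\<And>x. (\<Sum>A\<in>M. c A * mset_monomial S A x) = 0" and "A \<in> M"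
  shows "c A = 0"
proof (rule distinct_characters_independent[where I = M and V = "coord_space S"
        and mul = "\<lambda>x y a. x a * y a" and chi = "mset_monomial S" and c = c])
  define one where "one = (\<lambda>a. if a \<in> S then 1 else 0 :: complex)"
  have sub: "set_mset A \<subseteq> S" if "A \<in> M" for A
    using that assms(1) by (auto simp: multisets_of_size_def)
  show "\<exists>x\<in>coord_space S. mset_monomial S A x \<noteq> 0" if "A \<in> M" for A
  proof (rule bexI[of _ one])
    have "image_mset one A = image_mset (\<lambda>_. 1) A"
      using sub[OF that] by (intro image_mset_cong) (auto simp: one_def)
    then show "mset_monomial S A one \<noteq> 0"
      by (simp add: mset_monomial_def coord_space_def one_def)
  qed (simp add: one_def coord_space_def)
  show "\<exists>x\<in>coord_space S. mset_monomial S A x \<noteq> mset_monomial S B x"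
    if "A \<in> M" "B \<in> M" "A \<noteq> B" for A B
  proof -
    obtain a where a: "count A a \<noteq> count B a" using \<open>A \<noteq> B\<close> by (auto simp: multiset_eq_iff)
    have aS: "a \<in> S"
      using a sub[OF that(1)] sub[OF that(2)] by (metis count_inI subsetD)
    \<comment> \<open>At this point the monomial of \<open>C\<close> equals 2 to the power
      \<open>count C a\<close>, which separates \<open>A\<close> from \<open>B\<close>.\<close>
    define x where "x = one(a := 2)"
    have x: "x \<in> coord_space S" using aS by (auto simp: x_def one_def coord_space_def)
    have "mset_monomial S C x = 2 ^ count C a" if "C \<in> M" for C
    proof -
      have "(\<Prod>b\<in>#C. x b) = 2 ^ count C a" using sub[OF that]
        by (induction C) (auto simp: x_def one_def)
      then show ?thesis using x by (simp add: mset_monomial_def)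
    qed
    moreover have "(2::complex) ^ count A a \<noteq> 2 ^ count B a"
    proof
      assume "(2::complex) ^ count A a = 2 ^ count B a"
      then have "norm ((2::complex) ^ count A a) = norm ((2::complex) ^ count B a)" by simp
      then show False using a by (simp add: norm_power)
    qed
    ultimately show ?thesis using that(1,2) by (intro bexI[OF _ x]) simp
  qed
  show "(\<Sum>A\<in>M. c A * mset_monomial S A x) = 0" for x by (rule assms(3))
qed (use assms in \<open>auto simp: coord_space_def mset_monomial_def prod_mset.distrib\<close>)

lemma dual_coord_space_expansion:
  assumes l: "l \<in> dual_space (coord_space S)" and S: "finite S" and x: "x \<in> coord_space S"
  shows "l x = (\<Sum>a\<in>S. l (\<lambda>b. if b = a then 1 else 0) * x a)"
proof -
  have add: "l (y + z) = l y + l z" if "y \<in> coord_space S" "z \<in> coord_space S" for y z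
    using l that by (auto simp: dual_space_def)
  have scale: "l (cscale c y) = c * l y" if "y \<in> coord_space S" for y c
    using l that by (auto simp: dual_space_def)
  \<comment> \<open>Linearity of \<open>l\<close> is available only on \<open>coord_space S\<close>,
    so \<open>x\<close> is built up from its truncations to subsets \<open>T\<close> of
    \<open>S\<close>, all of which lie there.\<close>
  have expand: "l (\<lambda>b. if b \<in> T then x b else 0) = (\<Sum>a\<in>T. l (\<lambda>b. if b = a then 1 else 0) * x a)"
    if "T \<subseteq> S" for T
    using finite_subset[OF that S] that
  proof (induction T rule: finite_induct)
    case empty
    have "l (cscale 0 0) = 0" by (subst scale) (auto simp: coord_space_def)
    then show ?case by (simp add: cscale_def zero_fun_def)
  next
    case (insert a T)
    have "(\<lambda>b. if b \<in> insert a T then x b else 0) =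
        cscale (x a) (\<lambda>b. if b = a then 1 else 0) + (\<lambda>b. if b \<in> T then x b else 0)"
      using insert.hyps by (auto simp: cscale_def fun_eq_iff)
    moreover have "l \<dots> = x a * l (\<lambda>b. if b = a then 1 else 0) + l (\<lambda>b. if b \<in> T then x b else 0)"
      using insert.prems by (subst add, force simp: coord_space_def cscale_def, force simp: coord_space_def,
        subst scale, auto simp: coord_space_def)
    ultimately show ?case using insert by (simp add: mult.commute)
  qed
  have "(\<lambda>b. if b \<in> S then x b else 0) = x"
    using x by (auto simp: coord_space_def fun_eq_iff)
  then show ?thesis using expand[of S] by simp
qed

text \<open>By induction on the degree: the last factor is expanded in coordinates, and
  multiplication by one coordinate sends monomials of degree \<open>m\<close> to monomials of degree
  \<open>m + 1\<close>.\<close>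

lemma linear_form_products_in_span:
  assumes S: "finite S" and l: "\<forall>i<m. l i \<in> dual_space (coord_space S)"
  shows "(\<lambda>x. if x \<in> coord_space S then \<Prod>i<m. l i x else 0)
    \<in> cfun.span (mset_monomial S ` multisets_of_size S m)"
  using l
proof (induction m)
  case 0
  have "(\<lambda>x. if x \<in> coord_space S then \<Prod>i<0. l i x else 0) = mset_monomial S {#}"
    by (auto simp: mset_monomial_def)
  then show ?case by (auto intro: cfun.span_base)
next
  case (Suc m)
  define P where "P = (\<lambda>x. if x \<in> coord_space S then \<Prod>i<m. l i x else 0)"
  let ?W = "cfun.span (mset_monomial S ` multisets_of_size S (Suc m))"
  have P: "P \<in> cfun.span (mset_monomial S ` multisets_of_size S m)"
    unfolding P_def using Suc by auto
  have coord: "(\<lambda>x. x a * P x) \<in> ?W" if a: "a \<in> S" for a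
    using P
  proof (induction rule: cfun.span_induct)
    case base
    show ?case
    proof (rule cfun.subspaceI)
      show "0 \<in> {P. (\<lambda>x. x a * P x) \<in> ?W}"
        using cfun.span_zero[of "mset_monomial S ` multisets_of_size S (Suc m)"]
        by (simp add: zero_fun_def)
      show "P + Q \<in> {P. (\<lambda>x. x a * P x) \<in> ?W}"
        if "P \<in> {P. (\<lambda>x. x a * P x) \<in> ?W}" "Q \<in> {P. (\<lambda>x. x a * P x) \<in> ?W}" for P Q
      proof -
        have "(\<lambda>x. x a * (P + Q) x) = (\<lambda>x. x a * P x) + (\<lambda>x. x a * Q x)"
          by (auto simp: fun_eq_iff algebra_simps)
        then show ?thesis using that by (auto intro: cfun.span_add)
      qed
      show "cscale c P \<in> {P. (\<lambda>x. x a * P x) \<in> ?W}"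
        if "P \<in> {P. (\<lambda>x. x a * P x) \<in> ?W}" for P c
      proof -
        have "(\<lambda>x. x a * cscale c P x) = cscale c (\<lambda>x. x a * P x)"
          by (auto simp: fun_eq_iff cscale_def)
        then show ?thesis using that by (auto intro: cfun.span_scale)
      qed
    qed
  next
    case (step Q)
    then obtain A where A: "A \<in> multisets_of_size S m" "Q = mset_monomial S A" by auto
    have "(\<lambda>x. x a * Q x) = mset_monomial S (add_mset a A)"
      by (auto simp: A mset_monomial_def)
    moreover have "add_mset a A \<in> multisets_of_size S (Suc m)"
      using A a by (auto simp: multisets_of_size_def)
    ultimately show ?case by (auto intro: cfun.span_base)
  qed
  have "(\<lambda>x. if x \<in> coord_space S then \<Prod>i<Suc m. l i x else 0) =
      (\<Sum>a\<in>S. cscale (l m (\<lambda>b. if b = a then 1 else 0)) (\<lambda>x. x a * P x))"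
  proof
    fix x
    show "(if x \<in> coord_space S then \<Prod>i<Suc m. l i x else 0) =
      (\<Sum>a\<in>S. cscale (l m (\<lambda>b. if b = a then 1 else 0)) (\<lambda>x. x a * P x)) x"
      using dual_coord_space_expansion[of "l m" S x] Suc.prems S
      by (auto simp: sum_fun_apply cscale_def P_def sum_distrib_left sum_distrib_right
          mult_ac intro!: sum.cong)
  qed
  also have "\<dots> \<in> ?W" using coord by (intro cfun.span_sum cfun.span_scale) auto
  finally show ?case .
qed

text \<open>Any listing of the elements of \<open>A\<close> presents the monomial as a product of
  coordinate forms.\<close>

lemma mset_monomial_in_linear_form_products:
  assumes "A \<in> multisets_of_size S m"
  shows "mset_monomial S A \<in> linear_form_products (coord_space S) m"
proof -
  obtain xs where xs: "A = mset xs" by (metis ex_mset)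
  have len: "length xs = m" using assms xs by (auto simp: multisets_of_size_def)
  define l where "l = (\<lambda>i x. if x \<in> coord_space S then x (xs ! i) else 0 :: complex)"
  have "l i \<in> dual_space (coord_space S)" for i
    by (auto simp: l_def dual_space_def coord_space_def cscale_def)
  moreover have "mset_monomial S A = (\<lambda>x. if x \<in> coord_space S then \<Prod>i<m. l i x else 0)"
  proof
    fix x :: "'a \<Rightarrow> complex"
    have "(\<Prod>a\<in>#A. x a) = prod_list (map x xs)"
      by (simp add: xs prod_mset_prod_list flip: mset_map)
    also have "\<dots> = (\<Prod>i<m. x (xs ! i))"
      by (simp add: prod.list_conv_set_nth len atLeast0LessThan)
    finally show "mset_monomial S A x = (if x \<in> coord_space S then \<Prod>i<m. l i x else 0)"
      by (simp add: mset_monomial_def l_def)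
  qed
  ultimately show ?thesis unfolding linear_form_products_def by blast
qed

lemma homogeneous_polys_coord_space:
  assumes "finite S"
  shows "homogeneous_polys (coord_space S) m =
    cfun.span (mset_monomial S ` multisets_of_size S m)"
proof
  show "homogeneous_polys (coord_space S) m \<subseteq> cfun.span (mset_monomial S ` multisets_of_size S m)"
    unfolding homogeneous_polys_def
    by (rule cfun.span_minimal)
      (use linear_form_products_in_span[OF assms] in \<open>auto simp: linear_form_products_def\<close>)
  show "cfun.span (mset_monomial S ` multisets_of_size S m) \<subseteq> homogeneous_polys (coord_space S) m"
    unfolding homogeneous_polys_def
    by (rule cfun.span_mono) (use mset_monomial_in_linear_form_products in auto)
qed

section \<open>Orbit sums as a basis of the invariants\<close>

lemma cfun_span_image_coefficients:
  assumes "finite I" and "f \<in> cfun.span (h ` I)"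
  shows "\<exists>c. f = (\<Sum>i\<in>I. cscale (c i) (h i))"
  using assms(2)
proof (induction rule: cfun.span_induct)
  case base
  show ?case
  proof (rule cfun.subspaceI)
    show "0 \<in> {f. \<exists>c. f = (\<Sum>i\<in>I. cscale (c i) (h i))}"
      by (auto intro!: exI[of _ "\<lambda>_. 0"])
    show "f + g \<in> {f. \<exists>c. f = (\<Sum>i\<in>I. cscale (c i) (h i))}"
      if "f \<in> {f. \<exists>c. f = (\<Sum>i\<in>I. cscale (c i) (h i))}"
        "g \<in> {f. \<exists>c. f = (\<Sum>i\<in>I. cscale (c i) (h i))}" for f g
    proof -
      from that obtain c d where "f = (\<Sum>i\<in>I. cscale (c i) (h i))"
        "g = (\<Sum>i\<in>I. cscale (d i) (h i))" by auto
      then have "f + g = (\<Sum>i\<in>I. cscale (c i + d i) (h i))"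
        by (simp only: cfun.scale_left_distrib sum.distrib)
      then show ?thesis by (auto intro: exI[of _ "\<lambda>i. c i + d i"])
    qed
    show "cscale k f \<in> {f. \<exists>c. f = (\<Sum>i\<in>I. cscale (c i) (h i))}"
      if "f \<in> {f. \<exists>c. f = (\<Sum>i\<in>I. cscale (c i) (h i))}" for f k
    proof -
      from that obtain c where "f = (\<Sum>i\<in>I. cscale (c i) (h i))" by auto
      then have "cscale k f = (\<Sum>i\<in>I. cscale (k * c i) (h i))"
        by (simp only: cfun.scale_sum_right cfun.scale_scale)
      then show ?thesis by (auto intro: exI[of _ "\<lambda>i. k * c i"])
    qed
  qed
next
  case (step f)
  then obtain j where j: "j \<in> I" "f = h j" by auto
  have "(\<Sum>i\<in>I. cscale (if i = j then 1 else 0) (h i)) = (\<Sum>i\<in>I. if i = j then h i else 0)"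
    by (intro sum.cong) auto
  then have "f = (\<Sum>i\<in>I. cscale (if i = j then 1 else 0) (h i))"
    using j assms(1) by simp
  then show ?case by (auto intro: exI[of _ "\<lambda>i. if i = j then 1 else 0"])
qed

text \<open>Injectivity comes from the coefficients 1 and -1 at two indices with equal values. It
  ensures that the basis of orbit sums has as many elements as there are orbits.\<close>

lemma cfun_independent_family:
  assumes "finite I"
    and zero: "\<And>c i. (\<Sum>i\<in>I. cscale (c i) (h i)) = 0 \<Longrightarrow> i \<in> I \<Longrightarrow> c i = 0"
  shows "inj_on h I" and "cfun.independent (h ` I)"
proof -
  show inj: "inj_on h I"
  proof (rule inj_onI, rule ccontr)
    fix i j assume ij: "i \<in> I" "j \<in> I" "h i = h j" "i \<noteq> j"
    define c where "c = (\<lambda>k. if k = i then 1 else if k = j then -1 else 0 :: complex)"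
    have "(\<Sum>k\<in>I. cscale (c k) (h k)) = (\<Sum>k\<in>{i, j}. cscale (c k) (h k))"
      by (rule sum.mono_neutral_right) (use assms(1) ij in \<open>auto simp: c_def\<close>)
    also have "\<dots> = 0" using ij by (simp add: c_def)
    finally show False using zero[of c i] ij by (simp add: c_def)
  qed
  show "cfun.independent (h ` I)"
  proof (rule cfun.independent_if_scalars_zero)
    fix f x assume f: "(\<Sum>x\<in>h ` I. cscale (f x) x) = 0" and x: "x \<in> h ` I"
    have "(\<Sum>i\<in>I. cscale (f (h i)) (h i)) = 0" using f by (simp add: sum.reindex[OF inj])
    then show "f x = 0" using zero[of "\<lambda>i. f (h i)"] x by auto
  qed (use assms(1) in auto)
qed

text \<open>The map is restricted to the multisets of size \<open>m\<close> because the elements of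
  \<open>BijGroup\<close> are extensional functions.\<close>

definition mset_translation :: "('a, 'm) monoid_scheme \<Rightarrow> nat \<Rightarrow> 'a \<Rightarrow> 'a multiset \<Rightarrow> 'a multiset" where
  "mset_translation G m g =
     (\<lambda>A\<in>multisets_of_size (carrier G) m. image_mset (\<lambda>a. g \<otimes>\<^bsub>G\<^esub> a) A)"

lemma (in group) image_mset_inv_mult:
  assumes "set_mset A \<subseteq> carrier G" "g \<in> carrier G"
  shows "image_mset (\<lambda>a. inv g \<otimes> a) (image_mset (\<lambda>a. g \<otimes> a) A) = A"
proof -
  have "image_mset (\<lambda>a. inv g \<otimes> (g \<otimes> a)) A = image_mset (\<lambda>a. a) A"
    using assms by (intro image_mset_cong) (auto simp: m_assoc[symmetric])
  then show ?thesis by (simp add: multiset.map_comp comp_def)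
qed

lemma (in group) mset_translation_action:
  "group_action G (multisets_of_size (carrier G) m) (mset_translation G m)"
proof -
  let ?E = "multisets_of_size (carrier G) m"
  have mem: "image_mset (\<lambda>a. g \<otimes> a) A \<in> ?E" if "g \<in> carrier G" "A \<in> ?E" for g A
    using that by (auto simp: multisets_of_size_def)
  have inv1: "image_mset (\<lambda>a. inv g \<otimes> a) (image_mset (\<lambda>a. g \<otimes> a) A) = A"
    if "g \<in> carrier G" "A \<in> ?E" for g A
    using that by (intro image_mset_inv_mult) (auto simp: multisets_of_size_def)
  have bij: "bij_betw (mset_translation G m g) ?E ?E" if g: "g \<in> carrier G" for g
    by (rule bij_betwI[where g = "mset_translation G m (inv g)"])
      (use mem inv1[OF g] inv1[of "inv g"] g in \<open>auto simp: mset_translation_def\<close>)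
  have "mset_translation G m (g \<otimes> h) = compose ?E (mset_translation G m g) (mset_translation G m h)"
    if "g \<in> carrier G" "h \<in> carrier G" for g h
  proof
    fix A
    have "image_mset (\<lambda>a. g \<otimes> h \<otimes> a) A = image_mset (\<lambda>a. g \<otimes> (h \<otimes> a)) A" if "A \<in> ?E"
      using that \<open>g \<in> carrier G\<close> \<open>h \<in> carrier G\<close>
      by (intro image_mset_cong) (auto simp: multisets_of_size_def m_assoc)
    then show "mset_translation G m (g \<otimes> h) A
        = compose ?E (mset_translation G m g) (mset_translation G m h) A"
      using mem[OF that(2)] by (simp add: compose_def mset_translation_def multiset.map_comp comp_def)
  qed
  then have "mset_translation G m \<in> hom G (BijGroup ?E)"
    using bij by (auto simp: hom_def BijGroup_def Bij_def mset_translation_def)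
  then show ?thesis
    by (simp add: group_action_def group_hom_def group_hom_axioms_def group_BijGroup)
qed

text \<open>The coefficient of \<open>g\<close> times \<open>x\<close> at \<open>a\<close> is that
  of \<open>x\<close> at \<open>inv g \<otimes> a\<close>, so the translation moves to the index
  multiset with \<open>g\<close> inverted.\<close>

lemma (in group) mset_monomial_regular_rep:
  assumes "g \<in> carrier G" "x \<in> regular_space G" "A \<in> multisets_of_size (carrier G) m"
  shows "mset_monomial (carrier G) A (regular_rep G g x) =
    mset_monomial (carrier G) (mset_translation G m (inv g) A) x"
proof -
  have "image_mset (regular_rep G g x) A = image_mset (\<lambda>a. x (inv g \<otimes> a)) A"
    using assms(3) by (intro image_mset_cong) (auto simp: multisets_of_size_def regular_rep_def)
  moreover have "regular_rep G g x \<in> coord_space (carrier G)" "x \<in> coord_space (carrier G)"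
    using assms(2) by (auto simp: coord_space_def regular_rep_def regular_space_def)
  ultimately show ?thesis using assms(3)
    by (simp add: mset_monomial_def mset_translation_def multiset.map_comp comp_def)
qed

text \<open>The orbits partition the monomials, so the orbit sums are independent; they span because
  independence of the monomials forces the coefficients of an invariant to be constant on
  orbits.\<close>

lemma (in group) dim_invariant_polys_degree_orbits:
  assumes fin: "finite (carrier G)"
  shows "cfun.dim (invariant_polys_degree G (regular_space G) (regular_rep G) m) =
    card (orbits G (multisets_of_size (carrier G) m) (mset_translation G m))"
proof -
  let ?E = "multisets_of_size (carrier G) m" and ?T = "mset_translation G m"
  let ?V = "regular_space G" and ?mon = "mset_monomial (carrier G)"
  define Orb where "Orb = orbits G ?E ?T"
  define s where "s = (\<lambda>C. \<Sum>A\<in>C. ?mon A)"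
  interpret act: group_action G ?E ?T by (rule mset_translation_action)
  have finE: "finite ?E" using fin by auto
  have V: "?V = coord_space (carrier G)" by (simp add: regular_space_def coord_space_def)
  have hom: "homogeneous_polys ?V m = cfun.span (?mon ` ?E)"
    unfolding V by (rule homogeneous_polys_coord_space[OF fin])
  have poly: "homogeneous_polys ?V m \<subseteq> poly_functions ?V"
    unfolding homogeneous_polys_def poly_functions_def by (rule cfun.span_mono) auto
  have orb_sub: "C \<subseteq> ?E" if "C \<in> Orb" for C
    using that act.orbits_coverture by (auto simp: Orb_def)
  have finOrb: "finite Orb"
    using finE act.orbits_coverture by (metis Orb_def finite_UnionD)
  have orb_eq: "orbit G ?T A = C" if "C \<in> Orb" "A \<in> C" for A C
  proof -
    have "A \<in> ?E" using orb_sub that by auto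
    then have "A \<in> orbit G ?T A" "orbit G ?T A \<in> Orb"
      by (auto simp: act.orbit_refl Orb_def orbits_def)
    then show ?thesis using act.disjoint_union that by (auto simp: Orb_def)
  qed
  have trans_orb: "?T g ` C = C" if "g \<in> carrier G" "C \<in> Orb" for g C
  proof (rule endo_inj_surj)
    show "finite C" using finite_subset[OF orb_sub[OF that(2)] finE] .
    show "inj_on (?T g) C" using act.inj_prop[OF that(1)] orb_sub[OF that(2)] by (rule inj_on_subset)
    show "?T g ` C \<subseteq> C"
    proof
      fix B assume "B \<in> ?T g ` C"
      then obtain A where A: "A \<in> C" "B = ?T g A" by auto
      then have "B \<in> orbit G ?T A" using that(1) by (auto simp: orbit_def)
      then show "B \<in> C" using orb_eq[OF that(2) A(1)] by simp
    qed
  qed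
  \<comment> \<open>In a combination of orbit sums each monomial carries the coefficient of its
    orbit.\<close>
  have combination: "(\<Sum>C\<in>Orb. cscale (c C) (s C)) = (\<Sum>A\<in>?E. cscale (c (orbit G ?T A)) (?mon A))" for c
  proof -
    have "(\<Sum>C\<in>Orb. cscale (c C) (s C)) = (\<Sum>C\<in>Orb. \<Sum>A\<in>C. cscale (c (orbit G ?T A)) (?mon A))"
      using orb_eq by (intro sum.cong) (auto simp: s_def cfun.scale_sum_right)
    also have "\<dots> = (\<Sum>A\<in>?E. cscale (c (orbit G ?T A)) (?mon A))"
      unfolding Orb_def by (rule act.disjoint_sum[OF finE])
    finally show ?thesis .
  qed
  have coeff0: "c A = 0" if "\<And>x. (\<Sum>A\<in>?E. c A * ?mon A x) = 0" "A \<in> ?E" for c A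
    using mset_monomial_independent[of ?E "carrier G" m c A] finE that by simp
  have indep: "c C = 0" if eq: "(\<Sum>C\<in>Orb. cscale (c C) (s C)) = 0" and C: "C \<in> Orb" for c C
  proof -
    obtain A where A: "A \<in> ?E" "C = orbit G ?T A" using C by (auto simp: Orb_def orbits_def)
    have "(\<Sum>A\<in>?E. c (orbit G ?T A) * ?mon A x) = 0" for x
      using fun_cong[OF eq[unfolded combination], of x] by (simp add: sum_fun_apply cscale_def)
    then show ?thesis using coeff0[of "\<lambda>A. c (orbit G ?T A)"] A by simp
  qed
  have inj: "inj_on s Orb" and ind: "cfun.independent (s ` Orb)"
    by (rule cfun_independent_family[OF finOrb], erule (1) indep)+
  have "s ` Orb \<subseteq> invariant_polys_degree G ?V (regular_rep G) m"
  proof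
    fix f assume "f \<in> s ` Orb"
    then obtain C where C: "C \<in> Orb" "f = s C" by auto
    have "f \<in> homogeneous_polys ?V m"
      unfolding hom C s_def using orb_sub[OF C(1)] by (intro cfun.span_sum cfun.span_base) auto
    moreover have "f (regular_rep G g x) = f x" if "g \<in> carrier G" "x \<in> ?V" for g x
    proof -
      have "f (regular_rep G g x) = (\<Sum>A\<in>C. ?mon (?T (inv g) A) x)"
        using orb_sub[OF C(1)] that unfolding C s_def sum_fun_apply
        by (intro sum.cong mset_monomial_regular_rep) auto
      also have "\<dots> = (\<Sum>A\<in>?T (inv g) ` C. ?mon A x)"
        using act.inj_prop[of "inv g"] orb_sub[OF C(1)] that(1)
        by (subst sum.reindex) (auto intro: inj_on_subset)
      finally show ?thesis using trans_orb[of "inv g" C] that(1) C by (simp add: s_def sum_fun_apply)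
    qed
    ultimately show "f \<in> invariant_polys_degree G ?V (regular_rep G) m"
      using poly by (auto simp: invariant_polys_degree_def invariant_polys_def)
  qed
  moreover have "invariant_polys_degree G ?V (regular_rep G) m \<subseteq> cfun.span (s ` Orb)"
  proof
    fix f assume f: "f \<in> invariant_polys_degree G ?V (regular_rep G) m"
    then have "f \<in> cfun.span (?mon ` ?E)" by (auto simp: invariant_polys_degree_def hom)
    then obtain c where c: "f = (\<Sum>A\<in>?E. cscale (c A) (?mon A))"
      using cfun_span_image_coefficients[OF finE] by blast
    have fx: "f x = (\<Sum>A\<in>?E. c A * ?mon A x)" for x by (simp add: c sum_fun_apply cscale_def)
    \<comment> \<open>The expansions of \<open>f x\<close> and of \<open>f\<close> at the translate
      of \<open>x\<close> are compared after reindexing the latter by \<open>?T g\<close>.\<close>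
    have const: "c (?T g A) = c A" if g: "g \<in> carrier G" and A: "A \<in> ?E" for g A
    proof -
      have "(\<Sum>A\<in>?E. (c (?T g A) - c A) * ?mon A x) = 0" for x
      proof (cases "x \<in> ?V")
        case True
        have "f x = f (regular_rep G g x)"
          using f g True by (auto simp: invariant_polys_degree_def invariant_polys_def)
        also have "\<dots> = (\<Sum>A\<in>?E. c A * ?mon (?T (inv g) A) x)"
          unfolding fx using mset_monomial_regular_rep[OF g True] by (intro sum.cong) auto
        also have "\<dots> = (\<Sum>A\<in>?T g ` ?E. c A * ?mon (?T (inv g) A) x)"
          using act.surj_prop[OF g] by simp
        also have "\<dots> = (\<Sum>A\<in>?E. c (?T g A) * ?mon (?T (inv g) (?T g A)) x)"
          by (subst sum.reindex[OF act.inj_prop[OF g]]) simp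
        also have "\<dots> = (\<Sum>A\<in>?E. c (?T g A) * ?mon A x)"
          using act.orbit_sym_aux[OF g] by (intro sum.cong) auto
        finally show ?thesis by (simp add: fx algebra_simps sum_subtractf)
      qed (auto simp: mset_monomial_def V)
      then show ?thesis using coeff0[of "\<lambda>A. c (?T g A) - c A" A] A by simp
    qed
    \<comment> \<open>The coefficient of an orbit is read off at an arbitrary
      representative.\<close>
    define c' where "c' = (\<lambda>C. c (SOME A. A \<in> C))"
    have "c' (orbit G ?T A) = c A" if "A \<in> ?E" for A
    proof -
      have "(SOME B. B \<in> orbit G ?T A) \<in> orbit G ?T A"
        by (rule someI[of _ A]) (rule act.orbit_refl[OF that])
      then obtain g where "g \<in> carrier G" "(SOME B. B \<in> orbit G ?T A) = ?T g A"
        by (auto simp: orbit_def)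
      then show ?thesis using const[OF _ that] by (simp add: c'_def)
    qed
    then have "(\<Sum>A\<in>?E. cscale (c' (orbit G ?T A)) (?mon A)) = (\<Sum>A\<in>?E. cscale (c A) (?mon A))"
      by (intro sum.cong) auto
    then have "f = (\<Sum>C\<in>Orb. cscale (c' C) (s C))"
      by (simp only: c combination)
    also have "\<dots> \<in> cfun.span (s ` Orb)"
      by (intro cfun.span_sum cfun.span_scale cfun.span_base imageI)
    finally show "f \<in> cfun.span (s ` Orb)" .
  qed
  ultimately have "card (s ` Orb) = cfun.dim (invariant_polys_degree G ?V (regular_rep G) m)"
    using ind by (intro cfun.basis_card_eq_dim)
  then show ?thesis using card_image[OF inj] by (simp add: Orb_def)
qed

section \<open>Counting translation-invariant multisets\<close>

definition block_union :: "'a set multiset \<Rightarrow> 'a multiset" where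
  "block_union W = sum_mset (image_mset mset_set W)"

text \<open>A multiset with constant multiplicity on each block of a partition amounts to a choice
  of one multiplicity per block. Each chosen block contributes \<open>d\<close> elements, whence the
  condition on the size.\<close>

lemma bij_betw_block_union:
  assumes S: "finite S" and Un: "\<Union>Q = S" and disj: "pairwise disjnt Q"
    and card: "\<And>C. C \<in> Q \<Longrightarrow> card C = d" and d: "d > 0"
  shows "bij_betw block_union {W. set_mset W \<subseteq> Q \<and> d * size W = m}
    {A \<in> multisets_of_size S m. \<forall>C\<in>Q. \<forall>a\<in>C. \<forall>b\<in>C. count A a = count A b}"
    (is "bij_betw _ ?Z ?Y")
proof -
  have finC: "finite C" if "C \<in> Q" for C using S Un that by (meson Union_upper finite_subset)
  have cnt: "count (block_union W) a = count W C"
    if "set_mset W \<subseteq> Q" "C \<in> Q" "a \<in> C" for W C a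
    using that(1)
  proof (induction W)
    case (add C' W)
    have C': "C' \<in> Q" using add.prems by simp
    then have "finite C'" by (rule finC)
    moreover have "a \<in> C' \<longleftrightarrow> C' = C"
      using pairwiseD[OF disj C' that(2)] that(3) by (auto simp: disjnt_def)
    ultimately show ?case using add by (auto simp: block_union_def count_mset_set')
  qed (simp add: block_union_def)
  have set: "set_mset (block_union W) \<subseteq> S \<and> size (block_union W) = d * size W"
    if "set_mset W \<subseteq> Q" for W
    using that by (induction W) (use finC Un card in \<open>auto simp: block_union_def\<close>)
  \<comment> \<open>Whole blocks are peeled off: if \<open>A\<close> contains \<open>a\<close>, it
    contains the block of \<open>a\<close>, and removing that block keeps the multiplicities
    constant on blocks.\<close>
  have surj: "\<exists>W. set_mset W \<subseteq> Q \<and> block_union W = A"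
    if "set_mset A \<subseteq> S" "\<forall>C\<in>Q. \<forall>a\<in>C. \<forall>b\<in>C. count A a = count A b" for A
    using that
  proof (induction "size A" arbitrary: A rule: less_induct)
    case less
    show ?case
    proof (cases "A = {#}")
      case True
      then show ?thesis by (intro exI[of _ "{#}"]) (simp add: block_union_def)
    next
      case False
      then obtain a where a: "a \<in># A" by blast
      then obtain C where C: "C \<in> Q" "a \<in> C" using less.prems(1) Un by auto
      have "mset_set C \<subseteq># A"
      proof (rule mset_subset_eqI)
        fix b
        have "count A b \<ge> 1" if "b \<in> C" using less.prems(2) C a that by (metis count_greater_eq_one_iff)
        then show "count (mset_set C) b \<le> count A b"
          by (auto simp: count_mset_set')
      qed
      then obtain B where B: "A = mset_set C + B" by (metis subset_mset.le_iff_add)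
      have const: "count B b = count B b'" if "C' \<in> Q" "b \<in> C'" "b' \<in> C'" for C' b b'
      proof -
        have "b \<in> C \<longleftrightarrow> b' \<in> C"
          using pairwiseD[OF disj that(1) C(1)] that by (auto simp: disjnt_def)
        moreover have "count A b = count A b'" using less.prems(2) that by blast
        ultimately show ?thesis by (auto simp: B count_mset_set' split: if_splits)
      qed
      have "size B < size A" using card[OF C(1)] d by (simp add: B)
      moreover have "set_mset B \<subseteq> S" using less.prems(1) by (auto simp: B)
      moreover have "\<forall>C\<in>Q. \<forall>a\<in>C. \<forall>b\<in>C. count B a = count B b" by (intro ballI const)
      ultimately have "\<exists>W. set_mset W \<subseteq> Q \<and> block_union W = B" by (rule less.hyps)
      then obtain W where "set_mset W \<subseteq> Q" "block_union W = B" by blast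
      then show ?thesis using C(1)
        by (intro exI[of _ "add_mset C W"]) (auto simp: B block_union_def)
    qed
  qed
  show ?thesis
  proof (rule bij_betw_imageI)
    show "inj_on block_union ?Z"
    proof (rule inj_onI)
      fix W Y assume XY: "W \<in> ?Z" "Y \<in> ?Z" "block_union W = block_union Y"
      show "W = Y"
      proof (rule multiset_eqI)
        fix C
        show "count W C = count Y C"
        proof (cases "C \<in> Q")
          case True
          then obtain a where "a \<in> C" using card d by (metis card.empty ex_in_conv less_irrefl)
          then have "count W C = count (block_union W) a" "count Y C = count (block_union Y) a"
            using XY(1,2) True by (auto simp: cnt)
          then show ?thesis using XY(3) by simp
        next
          case False
          then show ?thesis using XY by (metis (mono_tags, lifting) count_inI mem_Collect_eq subsetD)
        qed
      qed
    qed
    show "block_union ` ?Z = ?Y"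
    proof
      show "block_union ` ?Z \<subseteq> ?Y" using set cnt by (auto simp: multisets_of_size_def)
      show "?Y \<subseteq> block_union ` ?Z"
      proof
        fix A assume A: "A \<in> ?Y"
        then have "set_mset A \<subseteq> S" "size A = m"
          and "\<forall>C\<in>Q. \<forall>a\<in>C. \<forall>b\<in>C. count A a = count A b"
          unfolding multisets_of_size_def by blast+
        then obtain W where W: "set_mset W \<subseteq> Q" "block_union W = A" using surj by blast
        then have "d * size W = m" using set \<open>size A = m\<close> by metis
        then show "A \<in> block_union ` ?Z" using W by (intro image_eqI[of _ _ W]) auto
      qed
    qed
  qed
qed

text \<open>The right cosets of the cyclic subgroup of \<open>g\<close> are the orbits of left
  multiplication by powers of \<open>g\<close>, so invariance of the multiplicities under
  \<open>g\<close> means constancy on these cosets.\<close>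

lemma (in group) translation_invariant_iff:
  assumes fin: "finite (carrier G)" and g: "g \<in> carrier G" and A: "A \<in> multisets_of_size (carrier G) m"
  shows "mset_translation G m g A = A \<longleftrightarrow>
    (\<forall>C\<in>rcosets (generate G {g}). \<forall>a\<in>C. \<forall>b\<in>C. count A a = count A b)"
proof -
  let ?H = "generate G {g}"
  have H: "subgroup ?H G" using g by (intro generate_is_subgroup) auto
  have sub: "set_mset A \<subseteq> carrier G" using A by (auto simp: multisets_of_size_def)
  have count_image: "count (image_mset (\<lambda>a. g \<otimes> a) A) (g \<otimes> a) = count A a" if a: "a \<in> carrier G" for a
  proof -
    have "count (image_mset (\<lambda>a. g \<otimes> a) A) (g \<otimes> a) = (\<Sum>b | b \<in># A \<and> g \<otimes> a = g \<otimes> b. count A b)"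
      by (simp add: count_image_mset')
    also have "{b. b \<in># A \<and> g \<otimes> a = g \<otimes> b} = (if a \<in># A then {a} else {})"
      using sub a g by (auto simp: subset_iff)
    finally show ?thesis by (auto simp: not_in_iff)
  qed
  have "mset_translation G m g A = A \<longleftrightarrow> (\<forall>a\<in>carrier G. count A (g \<otimes> a) = count A a)"
  proof
    assume "mset_translation G m g A = A"
    then show "\<forall>a\<in>carrier G. count A (g \<otimes> a) = count A a"
      using count_image A by (auto simp: mset_translation_def)
  next
    assume *: "\<forall>a\<in>carrier G. count A (g \<otimes> a) = count A a"
    have "image_mset (\<lambda>a. g \<otimes> a) A = A"
    proof (rule multiset_eqI)
      fix b
      show "count (image_mset (\<lambda>a. g \<otimes> a) A) b = count A b"
      proof (cases "b \<in> carrier G")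
        case True
        then have "b = g \<otimes> (inv g \<otimes> b)" using g by (simp add: m_assoc[symmetric])
        then show ?thesis using count_image[of "inv g \<otimes> b"] * True g by (metis inv_closed m_closed)
      next
        case False
        then have "b \<notin># A" "b \<notin># image_mset (\<lambda>a. g \<otimes> a) A" using sub g by auto
        then show ?thesis unfolding not_in_iff by simp
      qed
    qed
    then show "mset_translation G m g A = A" using A by (simp add: mset_translation_def)
  qed
  also have "\<dots> \<longleftrightarrow> (\<forall>C\<in>rcosets ?H. \<forall>a\<in>C. \<forall>b\<in>C. count A a = count A b)"
  proof
    assume *: "\<forall>a\<in>carrier G. count A (g \<otimes> a) = count A a"
    have pow: "count A (g [^] k \<otimes> a) = count A a" if "a \<in> carrier G" for k :: nat and a
      using that
    proof (induction k)
      case (Suc k)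
      have "g [^] Suc k \<otimes> a = g \<otimes> (g [^] k \<otimes> a)"
        unfolding nat_pow_Suc2[OF g] using g Suc.prems by (intro m_assoc) auto
      then show ?case using * Suc g by simp
    qed (use g in simp)
    have "count A b = count A a" if "a \<in> carrier G" "b \<in> ?H #> a" for a b
      using that pow generate_pow_on_finite_carrier[OF fin g] by (auto simp: r_coset_def)
    then show "\<forall>C\<in>rcosets ?H. \<forall>a\<in>C. \<forall>b\<in>C. count A a = count A b"
      by (auto simp: RCOSETS_def)
  next
    assume *: "\<forall>C\<in>rcosets ?H. \<forall>a\<in>C. \<forall>b\<in>C. count A a = count A b"
    show "\<forall>a\<in>carrier G. count A (g \<otimes> a) = count A a"
    proof
      fix a assume a: "a \<in> carrier G"
      have "?H #> a \<in> rcosets ?H" using a by (auto simp: RCOSETS_def)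
      moreover have "a \<in> ?H #> a" using a H by (rule rcos_self)
      moreover have "g \<otimes> a \<in> ?H #> a"
        by (auto simp: r_coset_def intro: generate.incl)
      ultimately show "count A (g \<otimes> a) = count A a" using * by blast
    qed
  qed
  finally show ?thesis .
qed

text \<open>A fixed multiset is a multiset of \<open>m div ord g\<close> cosets out of
  \<open>order G div ord g\<close>, each of size \<open>ord g\<close>; these are counted by stars
  and bars.\<close>

lemma (in group) card_translation_invariants:
  assumes fin: "finite (carrier G)" and g: "g \<in> carrier G"
  shows "card (invariants (multisets_of_size (carrier G) m) (mset_translation G m) g) =
    (if ord g dvd m then (order G div ord g + m div ord g - 1) choose (m div ord g) else 0)"
proof -
  let ?H = "generate G {g}" and ?E = "multisets_of_size (carrier G) m"
  have H: "subgroup ?H G" using g by (intro generate_is_subgroup) auto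
  have cardH: "card ?H = ord g" using generate_pow_card[OF g] by simp
  have pos: "ord g > 0" using ord_ge_1[OF fin g] by simp
  have finQ: "finite (rcosets ?H)" using rcosets_part_G[OF H] fin by (metis finite_UnionD)
  have cardQ: "card (rcosets ?H) = order G div ord g"
  proof -
    have "order G = card (rcosets ?H) * ord g" using lagrange_finite[OF fin H] cardH by simp
    then show ?thesis using pos by simp
  qed
  have cell: "card C = ord g" if "C \<in> rcosets ?H" for C
    using card_rcosets_equal[OF that subgroup.subset[OF H]] cardH by simp
  have bij: "bij_betw block_union {W. set_mset W \<subseteq> rcosets ?H \<and> ord g * size W = m}
      {A \<in> ?E. \<forall>C\<in>rcosets ?H. \<forall>a\<in>C. \<forall>b\<in>C. count A a = count A b}"
    by (rule bij_betw_block_union[OF fin rcosets_part_G[OF H] rcos_disjoint[OF H] cell pos])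
  have "invariants ?E (mset_translation G m) g =
      {A \<in> ?E. \<forall>C\<in>rcosets ?H. \<forall>a\<in>C. \<forall>b\<in>C. count A a = count A b}"
    unfolding invariants_def using translation_invariant_iff[OF fin g] by (intro Collect_cong conj_cong refl)
  also have "card \<dots> = card {W. set_mset W \<subseteq> rcosets ?H \<and> ord g * size W = m}"
    by (rule bij_betw_same_card[OF bij, symmetric])
  also have "\<dots> = (if ord g dvd m then (order G div ord g + m div ord g - 1) choose (m div ord g) else 0)"
  proof (cases "ord g dvd m")
    case True
    then have "{W. set_mset W \<subseteq> rcosets ?H \<and> ord g * size W = m} = multisets_of_size (rcosets ?H) (m div ord g)"
      using pos by (auto simp: multisets_of_size_def)
    then show ?thesis using True card_multisets_of_size[OF finQ] cardQ by simp
  next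
    case False
    then have none: "{W. set_mset W \<subseteq> rcosets ?H \<and> ord g * size W = m} = {}" by auto
    show ?thesis unfolding none using False by simp
  qed
  finally show ?thesis .
qed

text \<open>Symmetry gives the lower index \<open>a - 1\<close>, and the absorption identity does
  the rest.\<close>

lemma weighted_multichoose:
  fixes a b :: nat
  assumes "a > 0"
  shows "(a + b) * ((a + b - 1) choose b) = a * ((a + b) choose a)"
proof -
  have "(a + b - 1) choose b = (a + b - 1) choose (a - 1)"
    using assms by (subst binomial_symmetric) auto
  then show ?thesis using times_binomial_minus1_eq[of a "a + b"] assms by simp
qed

text \<open>
  Up to the factor \<open>n + h\<close> this is Molien's formula, in the form symmetric in \<open>n\<close> and \<open>h\<close> obtained from
  \<open>(a + b) * ((a + b - 1) choose b) = a * ((a + b) choose a)\<close> with \<open>a = n div d\<close> and \<open>b = h div d\<close>.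
\<close>

definition order_weighted_sum :: "('a, 'm) monoid_scheme \<Rightarrow> nat \<Rightarrow> nat \<Rightarrow> nat" where
  "order_weighted_sum G n h =
    (\<Sum>d | d dvd gcd n h. num_elems_of_order G d * (((n + h) div d) choose (n div d)))"

lemma (in group) dim_invariant_polys_degree:
  assumes fin: "finite (carrier G)" and h: "h > 0"
  shows "(order G + h) * cfun.dim (invariant_polys_degree G (regular_space G) (regular_rep G) h) =
    order_weighted_sum G (order G) h"
proof -
  let ?n = "order G" and ?E = "multisets_of_size (carrier G) h"
  let ?D = "cfun.dim (invariant_polys_degree G (regular_space G) (regular_rep G) h)"
  have n: "?n > 0" using fin order_gt_0_iff_finite by blast
  interpret act: group_action G ?E "mset_translation G h" by (rule mset_translation_action)
  have "?D * ?n = (\<Sum>g\<in>carrier G. card (invariants ?E (mset_translation G h) g))"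
    unfolding dim_invariant_polys_degree_orbits[OF fin] by (rule act.burnside) (use fin in auto)
  also have "\<dots> = (\<Sum>g\<in>carrier G. if ord g dvd h
      then (?n div ord g + h div ord g - 1) choose (h div ord g) else 0)"
    by (intro sum.cong card_translation_invariants fin) auto
  \<comment> \<open>The factor \<open>?n + h\<close> is inserted so that
    \<open>weighted_multichoose\<close>, scaled by \<open>ord g\<close>, applies to every summand at
    once.\<close>
  finally have "(?n + h) * (?D * ?n) = (\<Sum>g\<in>carrier G. if ord g dvd h
      then (?n + h) * ((?n div ord g + h div ord g - 1) choose (h div ord g)) else 0)"
    by (auto simp: sum_distrib_left intro!: sum.cong)
  also have "\<dots> = (\<Sum>g\<in>carrier G. if ord g dvd h
      then ?n * (((?n + h) div ord g) choose (?n div ord g)) else 0)"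
  proof (intro sum.cong refl if_cong)
    fix g assume g: "g \<in> carrier G" and "ord g dvd h"
    then obtain b where b: "h = ord g * b" by auto
    obtain a where a: "?n = ord g * a" using ord_dvd_group_order[OF g] by auto
    have pos: "ord g > 0" "a > 0" using n a by (auto intro: Nat.gr0I)
    have "(?n + h) * ((a + b - 1) choose b) = ?n * ((a + b) choose a)"
      using weighted_multichoose[OF pos(2), of b] unfolding a b
      by (metis distrib_left mult.assoc)
    moreover have "?n div ord g = a" "h div ord g = b" "(?n + h) div ord g = a + b"
      using pos by (auto simp: a b distrib_left[symmetric])
    ultimately show "(?n + h) * ((?n div ord g + h div ord g - 1) choose (h div ord g)) =
        ?n * (((?n + h) div ord g) choose (?n div ord g))" by simp
  qed
  also have "\<dots> = ?n * (\<Sum>g | g \<in> carrier G \<and> ord g dvd h. ((?n + h) div ord g) choose (?n div ord g))"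
    by (subst sum.inter_filter[OF fin]) (auto simp: sum_distrib_left intro!: sum.cong)
  also have "(\<Sum>g | g \<in> carrier G \<and> ord g dvd h. ((?n + h) div ord g) choose (?n div ord g)) =
      (\<Sum>d | d dvd gcd ?n h. \<Sum>g | g \<in> {g. g \<in> carrier G \<and> ord g dvd h} \<and> ord g = d.
        ((?n + h) div ord g) choose (?n div ord g))"
    using fin n ord_dvd_group_order by (intro sum.group[symmetric]) auto
  also have "\<dots> = order_weighted_sum G ?n h"
    unfolding order_weighted_sum_def
  proof (intro sum.cong refl)
    fix d assume "d \<in> {d. d dvd gcd ?n h}"
    then have "{g. g \<in> {g. g \<in> carrier G \<and> ord g dvd h} \<and> ord g = d} = {g \<in> carrier G. ord g = d}"
      by auto
    then show "(\<Sum>g | g \<in> {g. g \<in> carrier G \<and> ord g dvd h} \<and> ord g = d.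
        ((?n + h) div ord g) choose (?n div ord g)) =
        num_elems_of_order G d * (((?n + h) div d) choose (?n div d))"
      by (simp add: num_elems_of_order_def)
  qed
  finally show ?thesis using n by (simp add: mult.left_commute mult.commute)
qed

section \<open>Decay of the binomial coefficients\<close>

text \<open>The left side is one term of Vandermonde's sum.\<close>

lemma binomial_mult_le: "(m choose i) * (n choose j) \<le> (m + n) choose (i + j)"
proof -
  have "(m choose i) * (n choose j) \<le> (\<Sum>k\<le>i + j. (m choose k) * (n choose (i + j - k)))"
    by (rule order_trans[OF _ member_le_sum[of i]]) auto
  then show ?thesis by (simp add: vandermonde)
qed

lemma binomial_ge_linear:
  assumes "1 \<le> j" "j + 1 \<le> m"
  shows "m \<le> m choose j"
  using assms
proof (induction m arbitrary: j)
  case (Suc m)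
  then obtain i where i: "j = Suc i" by (cases j) auto
  show ?case
  proof (cases "j = m")
    case False
    then have "m \<le> m choose Suc i" using Suc.IH[of j] Suc.prems i by simp
    moreover have "0 < m choose i" using Suc.prems i by simp
    moreover have "Suc m choose j = (m choose i) + (m choose Suc i)" by (simp add: i)
    ultimately show ?thesis by linarith
  qed simp
qed simp

text \<open>In Pascal's rule the added entry is at least \<open>m\<close> by
  \<open>binomial_ge_linear\<close>, which covers the increment \<open>2 * m\<close> of
  \<open>m * (m - 1)\<close>. The border entries reduce to \<open>choose 2\<close> by
  symmetry.\<close>

lemma binomial_ge_quadratic:
  assumes "2 \<le> j" "j + 2 \<le> m"
  shows "m * (m - 1) \<le> 2 * (m choose j)"
  using assms
proof (induction m arbitrary: j)
  case (Suc m)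
  then obtain i where i: "j = Suc i" by (cases j) auto
  have lin: "m \<le> m choose i" using binomial_ge_linear[of i m] Suc.prems i by simp
  show ?case
  proof (cases "j + 2 \<le> m")
    case True
    then have "m * (m - 1) \<le> 2 * (m choose j)" using Suc by simp
    moreover have "Suc m * m = m * (m - 1) + 2 * m" by (cases m) auto
    ultimately show ?thesis using lin by (simp add: i)
  next
    case False
    then have j: "j = Suc m - 2" "2 \<le> Suc m" using Suc.prems by auto
    have "Suc m choose j = Suc m choose 2"
      unfolding j(1) using j(2) by (subst binomial_symmetric) auto
    then show ?thesis by (simp add: choose_two)
  qed
qed simp

text \<open>
  With \<open>n = g * u\<close>, \<open>h = g * v\<close> and \<open>g = gcd n h\<close>, the coefficient of the number of elements of order
  \<open>e\<close> in \<open>order_weighted_sum\<close> is \<open>scaled_binomial u v (g div e)\<close>.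
\<close>

definition scaled_binomial :: "nat \<Rightarrow> nat \<Rightarrow> nat \<Rightarrow> nat" where
  "scaled_binomial u v k = (k * (u + v)) choose (k * u)"

section \<open>Ratios of the weights\<close>

lemma scaled_binomial_mult_le:
  "k' \<le> k \<Longrightarrow> scaled_binomial u v (k - k') * scaled_binomial u v k' \<le> scaled_binomial u v k"
  unfolding scaled_binomial_def
  by (rule order_trans[OF binomial_mult_le]) (simp flip: distrib_right)

text \<open>By supermultiplicativity, a lower bound for the weight at \<open>k - k'\<close> bounds
  the ratio of the weights at \<open>k\<close> and \<open>k'\<close> from below.\<close>

lemma scaled_binomial_mult_bound:
  assumes "k' \<le> k" "B \<le> scaled_binomial u v (k - k')"
  shows "B * scaled_binomial u v k' \<le> scaled_binomial u v k"
  using mult_right_mono[OF assms(2)] scaled_binomial_mult_le[OF assms(1), of u v]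
  by (meson order_trans zero_le)

lemma scaled_binomial_ge:
  assumes "u > 0" "v > 0" "t \<ge> 2"
  shows "t * (u + v) * (t * (u + v) - 1) \<le> 2 * scaled_binomial u v t"
  unfolding scaled_binomial_def
proof (rule binomial_ge_quadratic)
  show "2 \<le> t * u" using mult_le_mono[OF assms(3), of 1 u] assms(1) by simp
  have "2 \<le> t * v" using mult_le_mono[OF assms(3), of 1 v] assms(2) by simp
  then show "t * u + 2 \<le> t * (u + v)" by (simp add: distrib_left)
qed

lemma scaled_binomial_ge_mult:
  assumes "u > 0" "v > 0" "t \<ge> 2" "2 * B \<le> (u + v) * (t * (u + v) - 1)"
  shows "t * B \<le> scaled_binomial u v t"
proof -
  have "2 * (t * B) \<le> t * ((u + v) * (t * (u + v) - 1))"
    using mult_le_mono2[OF assms(4), of t] by (simp add: mult_ac)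
  also have "\<dots> \<le> 2 * scaled_binomial u v t"
    using scaled_binomial_ge[OF assms(1-3)] by (simp add: mult_ac)
  finally show ?thesis by simp
qed

text \<open>Monotonicity in \<open>v\<close> and \<open>t\<close>: the estimates below need checking
  only at the smallest admissible values \<open>w\<close> and \<open>r\<close>.\<close>

lemma quadratic_lower_bound:
  fixes u v w t r :: nat
  assumes "w + u \<le> u + v" "r \<le> t" "1 \<le> r" "1 \<le> w"
  shows "(u + w) * (r * (u + w) - 1) \<le> (u + v) * (t * (u + v) - 1)"
  using assms by (intro mult_le_mono diff_le_mono) auto

text \<open>With \<open>n = d * k * u\<close>, multiplying by \<open>d\<close> gives
  \<open>n * w(e) <= d * w(d)\<close> for orders \<open>e >= 2 * d\<close>. The quadratic bound at
  \<open>t = k - k'\<close> suffices when \<open>t >= 2\<close>, because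
  \<open>k <= 2 * t\<close>.\<close>

lemma scaled_binomial_halving:
  assumes u: "u > 0" and v: "v > 0" and k: "2 * k' \<le> k" "k' > 0"
  shows "k * u * scaled_binomial u v k' \<le> scaled_binomial u v k"
proof (cases "k - k' \<ge> 2")
  case True
  define t where "t = k - k'"
  have t: "t \<ge> 2" "k \<le> 2 * t" "k' \<le> k" using True k by (auto simp: t_def)
  \<comment> \<open>This is the worst case \<open>v = 1\<close>, \<open>t = 2\<close>.\<close>
  have "(u + 1) * (2 * (u + 1) - 1) = 2 * (u * u) + 3 * u + 1" by (simp add: algebra_simps)
  moreover have "u \<le> u * u" by simp
  ultimately have "2 * (2 * u) \<le> (u + 1) * (2 * (u + 1) - 1)" by linarith
  also have "\<dots> \<le> (u + v) * (t * (u + v) - 1)" using t v by (intro quadratic_lower_bound) auto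
  finally have "t * (2 * u) \<le> scaled_binomial u v t" using scaled_binomial_ge_mult[OF u v t(1)] by blast
  moreover have "k * u \<le> t * (2 * u)"
  proof -
    have "k * u \<le> 2 * t * u" using t(2) by (rule mult_le_mono1)
    then show ?thesis by (simp only: mult_ac)
  qed
  ultimately have "k * u \<le> scaled_binomial u v (k - k')" unfolding t_def by (rule order_trans[rotated])
  then show ?thesis by (rule scaled_binomial_mult_bound[OF t(3)])
next
  case False
  then have k2: "k = 2" "k' = 1" using k by auto
  let ?c = "u + v"
  have one: "scaled_binomial u v 1 = ?c choose u" by (simp add: scaled_binomial_def)
  show ?thesis
  proof (cases "u = 1 \<or> v = 1")
    \<comment> \<open>Supermultiplicativity would give only the ratio \<open>?c\<close>, which for
      \<open>v = 1\<close> and \<open>u > 1\<close> is below \<open>2 * u\<close>. The weight at 2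
      is therefore compared directly with the weight \<open>?c\<close> at 1.\<close>
    case True
    have eq: "?c choose u = ?c"
    proof (cases "u = 1")
      case False
      then have "v = 1" using True by simp
      then show ?thesis by simp
    qed simp
    have lower: "?c * (2 * ?c - 1) \<le> scaled_binomial u v 2"
    proof -
      have "2 * (?c * (2 * ?c - 1)) \<le> 2 * scaled_binomial u v 2"
        using scaled_binomial_ge[OF u v order_refl] unfolding mult.assoc .
      then show ?thesis by (rule mult_left_le_imp_le) simp
    qed
    have upper: "2 * u * ?c \<le> ?c * (2 * ?c - 1)"
    proof -
      have "2 * u \<le> 2 * ?c - 1" using v by simp
      from mult_le_mono2[OF this, of ?c] show ?thesis by (simp only: mult_ac)
    qed
    show ?thesis unfolding k2 one eq by (rule order_trans[OF upper lower])
  next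
    case False
    then have uv: "u \<ge> 2" "v \<ge> 2" using u v by auto
    have "?c * (?c - 1) \<le> 2 * (?c choose u)"
      by (rule binomial_ge_quadratic) (use uv in auto)
    moreover have "4 * u \<le> ?c * (?c - 1)" using uv by (intro mult_le_mono) auto
    ultimately have "2 * u \<le> scaled_binomial u v 1" unfolding one by linarith
    then show ?thesis unfolding k2 using scaled_binomial_mult_bound[of 1 2 "2 * u" u v] by simp
  qed
qed

text \<open>The extra factor 2 lets these orders use up only half of the gap. The quadratic bound is
  evaluated at the smallest \<open>v\<close> and \<open>t\<close> of each case; for
  \<open>k = 4\<close>, \<open>t = 2\<close> it is too weak at \<open>u = v = 1\<close>, hence the
  condition on \<open>v\<close>.\<close>

lemma scaled_binomial_halving_strong:
  assumes u: "u > 0" and v: "v > 0" and k: "2 * k' \<le> k" "k \<ge> 3" and v2: "k = 4 \<Longrightarrow> v \<ge> 2"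
  shows "2 * k * u * scaled_binomial u v k' \<le> scaled_binomial u v k"
proof -
  define t where "t = k - k'"
  have t: "t \<ge> 2" "k \<le> 2 * t" "k' \<le> k" using k by (auto simp: t_def)
  have "2 * k * u \<le> scaled_binomial u v t"
  proof -
    consider "t \<ge> 3" | "t = 2" "k = 3" | "t = 2" "k = 4" using t k by linarith
    then show ?thesis
    proof cases
      case 1
      have "(u + 1) * (3 * (u + 1) - 1) = 3 * (u * u) + 5 * u + 2" by (simp add: algebra_simps)
      moreover have "u \<le> u * u" by simp
      ultimately have "2 * (4 * u) \<le> (u + 1) * (3 * (u + 1) - 1)" by linarith
      also have "\<dots> \<le> (u + v) * (t * (u + v) - 1)" using 1 v by (intro quadratic_lower_bound) auto
      finally have "t * (4 * u) \<le> scaled_binomial u v t" using scaled_binomial_ge_mult[OF u v t(1)] by blast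
      moreover have "2 * k * u \<le> t * (4 * u)"
      proof -
        have "k * (2 * u) \<le> 2 * t * (2 * u)" using t(2) by (rule mult_le_mono1)
        then show ?thesis by (simp only: mult_ac)
      qed
      ultimately show ?thesis by (rule order_trans[rotated])
    next
      case 2
      have "3 * u \<le> 2 * (u * u) + 1"
      proof (cases "u = 1")
        case False
        then have "2 * u \<le> u * u" using u by (intro mult_le_mono1) auto
        then show ?thesis by linarith
      qed simp
      then have "2 * (3 * u) \<le> (u + 1) * (2 * (u + 1) - 1)" by (simp add: algebra_simps)
      also have "\<dots> \<le> (u + v) * (t * (u + v) - 1)" using 2 v by (intro quadratic_lower_bound) auto
      finally have "t * (3 * u) \<le> scaled_binomial u v t" using scaled_binomial_ge_mult[OF u v t(1)] by blast
      then show ?thesis using 2 by simp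
    next
      case 3
      have "(u + 2) * (2 * (u + 2) - 1) = 2 * (u * u) + 7 * u + 6" by (simp add: algebra_simps)
      moreover have "u \<le> u * u" by simp
      ultimately have "2 * (4 * u) \<le> (u + 2) * (2 * (u + 2) - 1)" by linarith
      also have "\<dots> \<le> (u + v) * (t * (u + v) - 1)" using 3 v2 by (intro quadratic_lower_bound) auto
      finally have "t * (4 * u) \<le> scaled_binomial u v t" using scaled_binomial_ge_mult[OF u v t(1)] by blast
      then show ?thesis using 3 by simp
    qed
  qed
  then show ?thesis using scaled_binomial_mult_bound[OF t(3)] by (simp add: t_def)
qed

text \<open>For coprime \<open>d\<close> and \<open>e\<close> with \<open>g = d * e * s\<close>, the
  weights of \<open>d\<close> and \<open>e\<close> have parameters \<open>e * s\<close> and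
  \<open>d * s\<close>. Even the small difference \<open>t\<close> of these parameters yields the
  ratio \<open>3 * t * u\<close>.\<close>

lemma scaled_binomial_near:
  assumes u: "u > 0" and v: "v > 0" and de: "2 \<le> d" "d < e" and s: "s > 0"
    and v2: "s = 1 \<Longrightarrow> v \<ge> 2"
  shows "2 * (e * s) * u * scaled_binomial u v (d * s) \<le> d * scaled_binomial u v (e * s)"
proof -
  define t where "t = e * s - d * s"
  have ts: "t = (e - d) * s" by (simp add: t_def diff_mult_distrib)
  have st: "s \<le> t" unfolding ts using mult_le_mono1[of 1 "e - d" s] de by linarith
  have es: "e * s = d * s + t" using de by (simp add: t_def)
  have "3 * t * u \<le> scaled_binomial u v t"
  proof (cases "t \<ge> 2")
    case True
    have "3 * u \<le> 2 * (u * u) + 1"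
    proof (cases "u = 1")
      case False
      then have "2 * u \<le> u * u" using u by (intro mult_le_mono1) auto
      then show ?thesis by linarith
    qed simp
    then have "2 * (3 * u) \<le> (u + 1) * (2 * (u + 1) - 1)" by (simp add: algebra_simps)
    also have "\<dots> \<le> (u + v) * (t * (u + v) - 1)" using True v by (intro quadratic_lower_bound) auto
    finally have "t * (3 * u) \<le> scaled_binomial u v t" using scaled_binomial_ge_mult[OF u v True] by blast
    then show ?thesis by (simp add: mult_ac)
  next
    case False
    \<comment> \<open>Here the weight at \<open>t\<close> is the single binomial
      \<open>(u + v) choose u\<close>; it reaches \<open>3 * u\<close> thanks to
      \<open>v >= 2\<close>.\<close>
    then have t1: "t = 1" and s1: "s = 1" using st s by auto
    have v': "v \<ge> 2" using v2 s1 by simp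
    have one: "scaled_binomial u v 1 = (u + v) choose u" by (simp add: scaled_binomial_def)
    show ?thesis
    proof (cases "u = 1")
      case True
      then show ?thesis unfolding t1 one using v' by simp
    next
      case False
      then have u': "u \<ge> 2" using u by simp
      have "3 * u \<le> u * u + 2"
      proof (cases "u = 2")
        case False
        then have "3 * u \<le> u * u" using u' by (intro mult_le_mono1) auto
        then show ?thesis by linarith
      qed simp
      then have "2 * (3 * u) \<le> (u + 2) * (1 * (u + 2) - 1)" by (simp add: algebra_simps)
      also have "\<dots> \<le> (u + v) * (1 * (u + v) - 1)" using v' by (intro quadratic_lower_bound) auto
      also have "\<dots> \<le> 2 * ((u + v) choose u)"
        using binomial_ge_quadratic[of u "u + v"] u' v' by simp
      finally show ?thesis unfolding t1 one by simp
    qed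
  qed
  then have near: "3 * t * u * scaled_binomial u v (d * s) \<le> scaled_binomial u v (e * s)"
    using scaled_binomial_mult_bound[of "d * s" "e * s"] de by (simp add: t_def)
  \<comment> \<open>Since \<open>e * s = d * s + t\<close>, this follows from \<open>s <= t\<close>
    and \<open>2 <= d\<close>.\<close>
  have "2 * (e * s) * u \<le> d * (3 * t * u)"
  proof -
    have "d * s \<le> d * t" "2 * t \<le> d * t" using st de by auto
    moreover have "2 * (x + t) \<le> 3 * y" if "x \<le> y" "2 * t \<le> y" for x y :: nat
      using mult_le_mono2[OF that(1), of 2] that(2) by simp
    ultimately have "2 * (e * s) \<le> 3 * (d * t)" unfolding es by blast
    then have "2 * (e * s) * u \<le> 3 * (d * t) * u" by (rule mult_le_mono1)
    then show ?thesis by (simp add: mult_ac)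
  qed
  then have "2 * (e * s) * u * scaled_binomial u v (d * s) \<le> d * (3 * t * u) * scaled_binomial u v (d * s)"
    by (rule mult_le_mono1)
  also have "\<dots> = d * (3 * t * u * scaled_binomial u v (d * s))" by (rule mult.assoc)
  also have "\<dots> \<le> d * scaled_binomial u v (e * s)" by (rule mult_le_mono2[OF near])
  finally show ?thesis .
qed

section \<open>Element orders in finite abelian groups\<close>

text \<open>The order of the quotient of \<open>x\<close> and \<open>y\<close> divides both
  \<open>a\<close> and \<open>b\<close>.\<close>

lemma (in comm_group) coprime_pow_cancel:
  assumes "x \<in> carrier G" "y \<in> carrier G" and "coprime a (b :: nat)"
    and "x [^] a = y [^] a" "x [^] b = y [^] b"
  shows "x = y"
proof -
  define z where "z = x \<otimes> inv y"
  have z: "z \<in> carrier G" using assms(1,2) by (simp add: z_def)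
  have "z [^] k = \<one>" if "x [^] k = y [^] k" for k :: nat
    using that assms(1,2) by (simp add: z_def nat_pow_distrib nat_pow_inv)
  then have "ord z dvd a" "ord z dvd b" using assms(4,5) pow_eq_id[OF z] by auto
  then have "ord z = 1" using coprime_common_divisor[OF assms(3), of "ord z"] by simp
  then have "z = \<one>" using ord_eq_1[OF z] by simp
  moreover have "x = z \<otimes> y" using assms(1,2) by (simp add: z_def m_assoc)
  ultimately show ?thesis using assms(2) by simp
qed

lemma (in comm_group) ord_mult_coprime:
  assumes x: "x \<in> carrier G" and y: "y \<in> carrier G" and "coprime (ord x) (ord y)"
  shows "ord (x \<otimes> y) = ord x * ord y"
proof (rule dvd_antisym)
  show "ord (x \<otimes> y) dvd ord x * ord y" by (rule abelian_ord_mul_divides[OF x y])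
  let ?k = "ord (x \<otimes> y)"
  have pow: "(x \<otimes> y) [^] (?k * n) = \<one>" for n :: nat
    using x y by (simp add: pow_eq_id)
  have "x [^] (?k * ord y) = \<one>"
    using pow[of "ord y"] x y by (simp add: nat_pow_distrib pow_eq_id[of y, THEN iffD2])
  then have "ord x dvd ?k" using x assms(3) by (simp add: pow_eq_id coprime_dvd_mult_left_iff)
  moreover have "y [^] (?k * ord x) = \<one>"
    using pow[of "ord x"] x y by (simp add: nat_pow_distrib pow_eq_id[of x, THEN iffD2])
  then have "ord y dvd ?k"
    using y assms(3) by (simp add: pow_eq_id coprime_dvd_mult_left_iff coprime_commute)
  ultimately show "ord x * ord y dvd ?k" using assms(3) by (simp add: divides_mult)
qed

text \<open>Both inequalities come from injections, \<open>z\<close> to its powers with exponents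
  \<open>b\<close> and \<open>a\<close>, and a pair to its product. Injectivity rests on
  \<open>coprime_pow_cancel\<close>.\<close>

lemma (in comm_group) num_elems_of_order_mult:
  assumes fin: "finite (carrier G)" and "coprime a b" "a > 0" "b > 0"
  shows "num_elems_of_order G (a * b) = num_elems_of_order G a * num_elems_of_order G b"
proof -
  define E where "E = (\<lambda>k. {x \<in> carrier G. ord x = k})"
  have finO: "finite (E k)" for k using fin by (simp add: E_def)
  have ann: "x [^] k = \<one>" if "x \<in> E k" for x k using that by (auto simp: E_def pow_eq_id)
  have "card (E (a * b)) \<le> card (E a \<times> E b)"
  proof (rule card_inj_on_le[where f = "\<lambda>z. (z [^] b, z [^] a)"])
    show "inj_on (\<lambda>z. (z [^] b, z [^] a)) (E (a * b))"
      using coprime_pow_cancel[OF _ _ assms(2)] by (auto simp: inj_on_def E_def)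
    show "(\<lambda>z. (z [^] b, z [^] a)) ` E (a * b) \<subseteq> E a \<times> E b"
      using assms(3,4) by (auto simp: E_def ord_pow)
  qed (use finO in auto)
  moreover have "card (E a \<times> E b) \<le> card (E (a * b))"
  proof (rule card_inj_on_le[where f = "\<lambda>(x, y). x \<otimes> y"])
    show "inj_on (\<lambda>(x, y). x \<otimes> y) (E a \<times> E b)"
    proof (rule inj_onI, clarify)
      fix x y x' y'
      assume xy: "x \<in> E a" "y \<in> E b" "x' \<in> E a" "y' \<in> E b" and eq: "x \<otimes> y = x' \<otimes> y'"
      then have mem: "x \<in> carrier G" "y \<in> carrier G" "x' \<in> carrier G" "y' \<in> carrier G"
        by (auto simp: E_def)
      have "(x \<otimes> y) [^] b = (x' \<otimes> y') [^] b" by (simp only: eq)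
      then have "x [^] b = x' [^] b"
        using mem ann[OF xy(2)] ann[OF xy(4)] by (simp add: nat_pow_distrib)
      then have "x = x'"
        using coprime_pow_cancel[OF mem(1,3) assms(2)] ann[OF xy(1)] ann[OF xy(3)] by simp
      then show "x = x' \<and> y = y'" using eq mem by simp
    qed
    show "(\<lambda>(x, y). x \<otimes> y) ` (E a \<times> E b) \<subseteq> E (a * b)"
      using assms(2) by (auto simp: E_def ord_mult_coprime)
  qed (use finO in auto)
  ultimately show ?thesis by (simp add: card_cartesian_product num_elems_of_order_def E_def)
qed

lemma (in group) num_elems_of_order_1: "num_elems_of_order G 1 = 1"
proof -
  have "{x \<in> carrier G. ord x = 1} = {\<one>}" using ord_eq_1 by auto
  then show ?thesis by (simp add: num_elems_of_order_def)
qed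

section \<open>Torsion subgroups of prime power exponent\<close>

definition torsion :: "('a, 'm) monoid_scheme \<Rightarrow> nat \<Rightarrow> 'a set" where
  "torsion G n = {x \<in> carrier G. x [^]\<^bsub>G\<^esub> n = \<one>\<^bsub>G\<^esub>}"

lemma (in comm_group) torsion_subgroup: "subgroup (torsion G n) G"
  by (rule subgroupI) (auto simp: torsion_def nat_pow_inv nat_pow_distrib intro: exI[of _ \<one>])

lemma (in group) card_torsion_prime_power:
  assumes fin: "finite (carrier G)" and p: "Factorial_Ring.prime p"
  shows "card (torsion G (p ^ j)) = (\<Sum>i\<le>j. num_elems_of_order G (p ^ i))"
proof -
  have "torsion G (p ^ j) = (\<Union>i\<le>j. {x \<in> carrier G. ord x = p ^ i})"
    using divides_primepow_nat[OF p] by (auto simp: torsion_def pow_eq_id)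
  moreover have "card \<dots> = (\<Sum>i\<le>j. card {x \<in> carrier G. ord x = p ^ i})"
    using fin prime_gt_1_nat[OF p] by (intro card_UN_disjoint) auto
  ultimately show ?thesis by (simp add: num_elems_of_order_def)
qed

lemma (in group) subgroup_pow_card:
  assumes "subgroup H G" "x \<in> H"
  shows "x [^] card H = \<one>"
proof -
  interpret H: group "G\<lparr>carrier := H\<rparr>" using assms(1) by (rule subgroup_imp_group)
  have "x [^]\<^bsub>G\<lparr>carrier := H\<rparr>\<^esub> card H = \<one>"
    using H.pow_order_eq_1[of x] assms(2) by (simp add: order_def)
  then show ?thesis by (simp flip: nat_pow_consistent)
qed

text \<open>Sylow's theorem gives a subgroup of order \<open>p ^ j\<close>. Its elements are killed
  by \<open>p ^ j\<close>, so it lies in the torsion subgroup, and Lagrange applies.\<close>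

lemma (in comm_group) prime_power_dvd_card_torsion:
  assumes fin: "finite (carrier G)" and p: "Factorial_Ring.prime p" and dvd: "p ^ j dvd order G"
  shows "p ^ j dvd card (torsion G (p ^ j))"
proof -
  obtain m where "order G = p ^ j * m" using dvd by auto
  then obtain H where H: "subgroup H G" "card H = p ^ j"
    using sylow_thm[OF p is_group _ fin] by blast
  interpret H: subgroup H G by (rule H(1))
  have "H \<subseteq> torsion G (p ^ j)" using subgroup_pow_card[OF H(1)] H(2) H.subset by (auto simp: torsion_def)
  then have "subgroup H (G\<lparr>carrier := torsion G (p ^ j)\<rparr>)"
    using H(1) torsion_subgroup by (intro subgroup_incl)
  then have "card H dvd order (G\<lparr>carrier := torsion G (p ^ j)\<rparr>)"
    using group.lagrange[OF subgroup_imp_group[OF torsion_subgroup]] by (metis dvd_triv_right)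
  then show ?thesis using H(2) by (simp add: order_def)
qed

text \<open>If another prime \<open>q\<close> divided the order, a subgroup of order
  \<open>q\<close> would consist of elements killed by the coprime exponents \<open>q\<close> and
  \<open>p ^ j\<close>, hence be trivial.\<close>

lemma (in comm_group) card_torsion_is_prime_power:
  assumes fin: "finite (carrier G)" and p: "Factorial_Ring.prime p"
  shows "\<exists>i. card (torsion G (p ^ j)) = p ^ i"
proof -
  let ?T = "torsion G (p ^ j)"
  have T: "subgroup ?T G" by (rule torsion_subgroup)
  have finT: "finite ?T" using fin by (simp add: torsion_def)
  have only: "q = p" if q: "Factorial_Ring.prime q" and dvd: "q dvd card ?T" for q
  proof (rule ccontr)
    assume "q \<noteq> p"
    then have cop: "coprime q (p ^ j)" using p q by (simp add: primes_coprime)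
    obtain m where "order (G\<lparr>carrier := ?T\<rparr>) = q ^ 1 * m" using dvd by (auto simp: order_def)
    then obtain H where H: "subgroup H (G\<lparr>carrier := ?T\<rparr>)" "card H = q"
      using sylow_thm[OF q subgroup_imp_group[OF T]] finT by fastforce
    then have HG: "subgroup H G" using incl_subgroup[OF T] by blast
    have "H \<subseteq> ?T" using subgroup.subset[OF H(1)] by simp
    have "x = \<one>" if "x \<in> H" for x
      using coprime_pow_cancel[OF _ _ cop, of x \<one>] subgroup_pow_card[OF HG that] H(2) that \<open>H \<subseteq> ?T\<close>
      by (auto simp: torsion_def)
    then have "card H \<le> card {\<one>}" by (intro card_mono) auto
    then show False using H(2) prime_gt_1_nat[OF q] by simp
  qed
  have "\<one> \<in> ?T" by (simp add: torsion_def)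
  then have "card ?T \<noteq> 0" using finT by auto
  then obtain m where m: "\<not> p dvd m" "card ?T = p ^ multiplicity p (card ?T) * m"
    using multiplicity_decompose'[of "card ?T" p] p by (metis not_prime_unit)
  have "m = 1"
  proof (rule ccontr)
    assume "m \<noteq> 1"
    then obtain q where "Factorial_Ring.prime q" "q dvd m" using prime_factor_nat by blast
    then show False using only[of q] m by (metis dvd_mult)
  qed
  then show ?thesis using m(2) by auto
qed

text \<open>As the counts agree below \<open>p ^ j\<close>, the gap is the difference of the two
  torsion orders, both multiples of \<open>p ^ j\<close>. The larger one is a power of
  \<open>p\<close> above \<open>p ^ j\<close>, so it is divisible by
  \<open>p * p ^ j\<close>.\<close>

lemma prime_power_order_gap:
  assumes K: "comm_group K" "finite (carrier K)" and L: "comm_group L" "finite (carrier L)"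
    and p: "Factorial_Ring.prime p" and dvd: "p ^ j dvd order K" "p ^ j dvd order L"
    and eq: "\<And>i. i < j \<Longrightarrow> num_elems_of_order K (p ^ i) = num_elems_of_order L (p ^ i)"
    and less: "num_elems_of_order K (p ^ j) < num_elems_of_order L (p ^ j)"
  shows "num_elems_of_order K (p ^ j) + p ^ j \<le> num_elems_of_order L (p ^ j)"
    and "p * p ^ j dvd order L"
proof -
  interpret K: comm_group K by (rule K)
  interpret L: comm_group L by (rule L)
  let ?d = "p ^ j" and ?k = "card (torsion K (p ^ j))" and ?l = "card (torsion L (p ^ j))"
  have "(\<Sum>i<j. num_elems_of_order K (p ^ i)) = (\<Sum>i<j. num_elems_of_order L (p ^ i))"
    using eq by (intro sum.cong) auto
  then have diff: "?l + num_elems_of_order K ?d = ?k + num_elems_of_order L ?d"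
    using K.card_torsion_prime_power[OF K(2) p, of j] L.card_torsion_prime_power[OF L(2) p, of j]
    by (simp flip: lessThan_Suc_atMost)
  obtain a b where ab: "?k = ?d * a" "?l = ?d * b"
    using K.prime_power_dvd_card_torsion[OF K(2) p dvd(1)] L.prime_power_dvd_card_torsion[OF L(2) p dvd(2)]
    by (auto elim!: dvdE)
  have "?d * a < ?d * b" using diff less ab by linarith
  then have "a + 1 \<le> b" by simp
  then have step: "?k + ?d \<le> ?l" using mult_le_mono2[of "a + 1" b ?d] by (simp add: ab)
  then show "num_elems_of_order K ?d + ?d \<le> num_elems_of_order L ?d" using diff by linarith
  obtain i where i: "?l = p ^ i" using L.card_torsion_is_prime_power[OF L(2) p] by blast
  have "?d > 0" using p by (simp add: prime_gt_0_nat)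
  moreover have "?k > 0" using K(2) by (auto simp: card_gt_0_iff torsion_def)
  ultimately have "p ^ j < p ^ i" using step i by linarith
  then have "Suc j \<le> i" using prime_gt_1_nat[OF p] by (simp add: Suc_le_eq)
  then have "p ^ Suc j dvd ?l" unfolding i by (rule le_imp_power_dvd)
  also have "?l dvd order L" using L.lagrange[OF L.torsion_subgroup] by (metis dvd_triv_right)
  finally show "p * ?d dvd order L" by simp
qed

text \<open>Products of elements of \<open>S\<close> with \<open>p ^ j\<close>-torsion elements are
  distinct: raising to the power \<open>p ^ j\<close> removes the torsion factor and is injective on
  \<open>S\<close>.\<close>

lemma (in comm_group) card_coprime_order_le:
  assumes fin: "finite (carrier G)" and p: "Factorial_Ring.prime p" and dvd: "p ^ j dvd order G"
    and S: "S \<subseteq> {x \<in> carrier G. \<not> p dvd ord x}"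
  shows "card S * p ^ j \<le> order G"
proof -
  let ?T = "torsion G (p ^ j)"
  have finT: "finite ?T" using fin by (simp add: torsion_def)
  have "card (S \<times> ?T) \<le> card (carrier G)"
  proof (rule card_inj_on_le[where f = "\<lambda>(x, y). x \<otimes> y"])
    show "inj_on (\<lambda>(x, y). x \<otimes> y) (S \<times> ?T)"
    proof (rule inj_onI, clarify)
      fix x y x' y'
      assume xy: "x \<in> S" "y \<in> ?T" "x' \<in> S" "y' \<in> ?T" and eq: "x \<otimes> y = x' \<otimes> y'"
      then have mem: "x \<in> carrier G" "y \<in> carrier G" "x' \<in> carrier G" "y' \<in> carrier G"
        using S by (auto simp: torsion_def)
      have "(x \<otimes> y) [^] (p ^ j) = (x' \<otimes> y') [^] (p ^ j)" by (simp only: eq)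
      then have "x [^] (p ^ j) = x' [^] (p ^ j)"
        using mem xy(2,4) by (simp add: nat_pow_distrib torsion_def)
      moreover have "x [^] (ord x * ord x') = x' [^] (ord x * ord x')"
        using mem by (simp add: pow_eq_id[THEN iffD2])
      moreover have "coprime (ord x * ord x') (p ^ j)"
      proof -
        have "\<not> p dvd ord x" "\<not> p dvd ord x'" using xy(1,3) S by auto
        then have "coprime p (ord x)" "coprime p (ord x')" using p by (auto intro: prime_imp_coprime)
        then show ?thesis by (simp add: coprime_commute)
      qed
      ultimately have "x = x'" using coprime_pow_cancel[OF mem(1,3)] by blast
      then show "x = x' \<and> y = y'" using eq mem by simp
    qed
    show "(\<lambda>(x, y). x \<otimes> y) ` (S \<times> ?T) \<subseteq> carrier G" using S by (auto simp: torsion_def)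
  qed (use fin in auto)
  then have "card S * card ?T \<le> order G" by (simp add: card_cartesian_product order_def)
  moreover have "p ^ j \<le> card ?T"
  proof (rule dvd_imp_le[OF prime_power_dvd_card_torsion[OF fin p dvd]])
    have "\<one> \<in> ?T" by (simp add: torsion_def)
    then show "0 < card ?T" using finT by (auto simp: card_gt_0_iff)
  qed
  ultimately show ?thesis using mult_le_mono2[of "p ^ j" "card ?T" "card S"] by linarith
qed

lemma (in group) sum_num_elems_of_order:
  assumes "finite (carrier G)" "finite D"
  shows "(\<Sum>e\<in>D. num_elems_of_order G e) = card {x \<in> carrier G. ord x \<in> D}"
proof -
  have "(\<Sum>e\<in>D. card {x \<in> carrier G. ord x = e}) = card (\<Union>e\<in>D. {x \<in> carrier G. ord x = e})"
    using assms by (intro card_UN_disjoint[symmetric]) auto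
  also have "(\<Union>e\<in>D. {x \<in> carrier G. ord x = e}) = {x \<in> carrier G. ord x \<in> D}" by auto
  finally show ?thesis by (simp add: num_elems_of_order_def)
qed

section \<open>Comparison of the two dimensions\<close>

lemma prime_power_cofactor:
  fixes n p :: nat
  assumes "n > 0" "Factorial_Ring.prime p" "p dvd n"
  obtains i m where "n = p ^ i * m" "\<not> p dvd m" "i > 0" "coprime (p ^ i) m" "m > 0"
proof -
  obtain m where m: "\<not> p dvd m" "n = p ^ multiplicity p n * m"
    using multiplicity_decompose'[of n p] assms(1,2) by (metis not_prime_unit less_irrefl)
  have "coprime (p ^ multiplicity p n) m" using prime_imp_coprime[OF assms(2) m(1)] by simp
  moreover have "multiplicity p n > 0" using m assms(3) by (metis gr0I mult_1 power_0)
  moreover have "m > 0" using m(2) assms(1) by (metis gr0I mult_0_right less_irrefl)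
  ultimately show ?thesis using that[OF m(2,1)] by blast
qed

lemma order_weighted_sum_commute: "order_weighted_sum G n h = order_weighted_sum G h n"
  unfolding order_weighted_sum_def
proof (rule sum.cong)
  fix d assume "d \<in> {d. d dvd gcd h n}"
  then have "d dvd n" "d dvd h" by auto
  then have "(n + h) div d = n div d + h div d" "(h + n) div d = h div d + n div d"
    by (simp_all add: div_plus_div_distrib_dvd_left)
  then show "num_elems_of_order G d * ((n + h) div d choose n div d) =
      num_elems_of_order G d * ((h + n) div d choose h div d)"
    using binomial_symmetric[of "n div d" "n div d + h div d"] by (simp add: add.commute)
qed (simp add: gcd.commute)

text \<open>The terms below \<open>d\<close> agree and the gap at \<open>d\<close> is worth at least
  \<open>d * w d\<close>. It remains to see that the terms of \<open>K\<close> above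
  \<open>d\<close> where the counts differ sum to less; those of \<open>L\<close> are only bounded
  below by zero.\<close>

lemma order_weighted_sum_less:
  fixes K :: "('a, 'm) monoid_scheme" and L :: "('b, 'n) monoid_scheme"
  assumes K: "comm_group K" "finite (carrier K)" and L: "comm_group L" "finite (carrier L)"
    and dvd: "d dvd gcd (order K) (order L)"
    and min: "\<And>e. e dvd gcd (order K) (order L) \<Longrightarrow> e < d \<Longrightarrow>
      num_elems_of_order K e = num_elems_of_order L e"
    and less: "num_elems_of_order K d < num_elems_of_order L d"
  shows "order_weighted_sum K (order K) (order L) < order_weighted_sum L (order K) (order L)"
proof -
  interpret K: comm_group K by (rule K)
  interpret L: comm_group L by (rule L)
  let ?n = "order K" and ?h = "order L"
  define f where "f = num_elems_of_order K"
  define f' where "f' = num_elems_of_order L"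
  define g where "g = gcd ?n ?h"
  have n: "?n > 0" and h: "?h > 0"
    using K(2) L(2) K.order_gt_0_iff_finite L.order_gt_0_iff_finite by auto
  then have g: "g > 0" by (simp add: g_def)
  have dg: "d dvd g" using dvd by (simp add: g_def)
  then have d0: "d > 0" using g by (auto intro: Nat.gr0I)
  obtain u v where uv: "?n = g * u" "?h = g * v"
    using gcd_dvd1[of ?n ?h] gcd_dvd2[of ?n ?h] unfolding g_def[symmetric] by (auto elim!: dvdE)
  have u: "u > 0" and v: "v > 0" using n h uv by (auto intro: Nat.gr0I)
  have mult: "f (a * b) = f a * f b" "f' (a * b) = f' a * f' b"
    if "coprime a b" "a > 0" "b > 0" for a b
    unfolding f_def f'_def
    using K.num_elems_of_order_mult[OF K(2) that] L.num_elems_of_order_mult[OF L(2) that] by auto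
  have min': "f e = f' e" if "e dvd g" "e < d" for e
    using min that by (simp add: f_def f'_def g_def)
  have less': "f d < f' d" using less by (simp add: f_def f'_def)
  have "f 1 = f' 1" unfolding f_def f'_def K.num_elems_of_order_1 L.num_elems_of_order_1 ..
  then have d1: "d \<noteq> 1" using less' by auto
  obtain p where p: "Factorial_Ring.prime p" "p dvd d" using prime_factor_nat[OF d1] by blast
  have p2: "p \<ge> 2" using prime_ge_2_nat[OF p(1)] .
  obtain j where j: "d = p ^ j" "j > 0"
  proof -
    obtain j m where jm: "d = p ^ j * m" "\<not> p dvd m" "j > 0" "coprime (p ^ j) m" "m > 0"
      using prime_power_cofactor[OF d0 p] by blast
    have "p ^ 1 \<le> p ^ j" using jm(3) p2 by (intro power_increasing) auto
    then have pj: "p ^ j > 1" using p2 by simp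
    \<comment> \<open>Otherwise both factors are divisors of \<open>g\<close> below
      \<open>d\<close>, and multiplicativity would make the counts agree at
      \<open>d\<close>.\<close>
    have "m = 1"
    proof (rule ccontr)
      assume "m \<noteq> 1"
      then have "p ^ j < d" "m < d" using jm(1,5) pj p2 by auto
      moreover have "p ^ j dvd g" "m dvd g" using jm(1) dg by (auto intro: dvd_trans)
      ultimately have "f (p ^ j) = f' (p ^ j)" "f m = f' m" using min' by auto
      then have "f d = f' d" using mult[OF jm(4)] jm(1,5) pj p2 by simp
      then show False using less' by simp
    qed
    then show ?thesis using that jm by simp
  qed
  have dK: "p ^ j dvd ?n" and dL: "p ^ j dvd ?h" using dg j(1) by (auto simp: g_def)
  have powers: "num_elems_of_order K (p ^ i) = num_elems_of_order L (p ^ i)" if "i < j" for i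
  proof (rule min)
    show "p ^ i < d" unfolding j(1) using that p2 by (intro power_strict_increasing) auto
    show "p ^ i dvd gcd ?n ?h"
      using dvd_trans[OF le_imp_power_dvd[of i j p] dg[unfolded j(1)]] that by (simp add: g_def)
  qed
  have gap: "f d + d \<le> f' d" and pd: "p * d dvd ?h"
    using prime_power_order_gap[OF K L p(1) dK dL powers] less unfolding f_def f'_def j(1) by auto
  define w where "w = (\<lambda>e. scaled_binomial u v (g div e))"
  have w: "((?n + ?h) div e) choose (?n div e) = w e" if e: "e dvd g" for e
  proof -
    obtain k where k: "g = e * k" using e by auto
    then have "e > 0" using g by (auto intro: Nat.gr0I)
    moreover have "?n = e * (k * u)" "?n + ?h = e * (k * (u + v))"
      using uv k by (simp_all add: algebra_simps)
    ultimately show ?thesis using k by (simp add: w_def scaled_binomial_def)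
  qed
  have sums: "order_weighted_sum M ?n ?h = (\<Sum>e | e dvd g. num_elems_of_order M e * w e)"
    for M :: "('c, 'k) monoid_scheme"
    unfolding order_weighted_sum_def g_def[symmetric] by (intro sum.cong refl) (simp add: w)
  define k where "k = g div d"
  have gk: "g = d * k" using dg by (simp add: k_def)
  have wd: "w d = scaled_binomial u v k" by (simp add: w_def k_def)
  have wd0: "w d > 0" by (simp add: wd scaled_binomial_def)
  \<comment> \<open>The orders above \<open>d\<close> that may compensate the gap at \<open>d\<close>. For those in \<open>R1\<close> the binomial has at
    most halved its parameters, which beats the trivial bound \<open>?n\<close> on the number of elements. For those
    in \<open>R2\<close> the binomial may be nearly as large, but minimality of \<open>d\<close> makes such orders coprime to
    \<open>p\<close>, so that there are at most \<open>?n / d\<close> elements.\<close>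
  define R where "R = {e. e dvd g \<and> d < e \<and> f e \<noteq> f' e}"
  define R1 where "R1 = {e \<in> R. 2 * d \<le> e}"
  define R2 where "R2 = {e \<in> R. e < 2 * d}"
  have finD: "finite {e. e dvd g}" using g by simp
  have finR: "finite R" by (rule finite_subset[OF _ finD]) (auto simp: R_def)
  have finR12: "finite R1" "finite R2" using finR by (auto simp: R1_def R2_def)
  have R: "R = R1 \<union> R2" "R1 \<inter> R2 = {}" by (auto simp: R1_def R2_def)
  have not_p: "\<not> p dvd e" if e: "e \<in> R2" for e
  proof
    assume "p dvd e"
    have e': "e dvd g" "d < e" "f e \<noteq> f' e" "e < 2 * d" using e by (auto simp: R2_def R_def)
    obtain i m where im: "e = p ^ i * m" "\<not> p dvd m" "i > 0" "coprime (p ^ i) m" "m > 0"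
      using prime_power_cofactor[OF _ p(1) \<open>p dvd e\<close>] e' by auto
    \<comment> \<open>If \<open>i < j\<close>, the counts agree at \<open>p ^ i\<close> and hence
      differ at \<open>m\<close>, which forces \<open>m >= d\<close>. If \<open>i = j\<close>,
      \<open>e\<close> would be a multiple of \<open>d\<close> strictly between \<open>d\<close> and
      \<open>2 * d\<close>. If \<open>i > j\<close>, then \<open>e >= p * d\<close>.\<close>
    consider "i < j" | "i = j" | "i > j" by linarith
    then show False
    proof cases
      case 1
      then have "p ^ i < d" unfolding j(1) using p2 by (intro power_strict_increasing) auto
      moreover have div: "p ^ i dvd g" "m dvd g" using im(1) e'(1) by (auto intro: dvd_trans)
      ultimately have "f (p ^ i) = f' (p ^ i)" using min' by auto
      then have "f m \<noteq> f' m" using e'(3) mult[OF im(4)] im(1,5) p2 by auto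
      then have "d \<le> m" using min'[OF div(2)] by force
      moreover have "p ^ 1 \<le> p ^ i" using im(3) p2 by (intro power_increasing) auto
      then have "2 \<le> p ^ i" using p2 by simp
      ultimately have "2 * d \<le> e" unfolding im(1) by (intro mult_le_mono)
      then show False using e'(4) by simp
    next
      case 2
      then have "e = d * m" using im(1) j(1) by simp
      then have "d < d * m" "d * m < 2 * d" using e' by auto
      then show False using d0 by (simp add: mult.commute[of 2])
    next
      case 3
      then have "p ^ Suc j \<le> p ^ i" using p2 by (intro power_increasing) auto
      then have "p * d \<le> e" unfolding im(1) j(1) using im(5) by (metis le_trans power_Suc mult_le_mono mult_1_right Suc_leI One_nat_def)
      moreover have "2 * d \<le> p * d" using p2 by simp
      ultimately show False using e'(4) by linarith
    qed
  qed
  have near: "3 \<le> k \<and> (k = 4 \<longrightarrow> v \<ge> 2) \<and> 2 * ?n * w e \<le> d * (d * w d)" if e: "e \<in> R2" for e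
  proof -
    have e': "e dvd g" "d < e" using e by (auto simp: R2_def R_def)
    have "coprime d e" using prime_imp_coprime[OF p(1) not_p[OF e]] j by simp
    then have "d * e dvd g" using dg e'(1) by (simp add: divides_mult)
    then obtain s where s: "g = d * e * s" by auto
    then have s0: "s > 0" using g by (auto intro: Nat.gr0I)
    have k': "k = e * s" using s gk d0 by simp
    have we: "w e = scaled_binomial u v (d * s)" using s e'(2) by (simp add: w_def mult_ac)
    have d2: "d \<ge> 2" using d0 d1 by simp
    \<comment> \<open>\<open>p * d\<close> divides \<open>?h\<close> but not \<open>d * e\<close>.\<close>
    have v2: "v \<ge> 2" if "s = 1"
    proof (rule ccontr)
      assume "\<not> v \<ge> 2"
      then have "v = 1" using v by simp
      then have "d * p dvd d * e" using pd uv(2) s that by (simp add: mult.commute)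
      then show False using not_p[OF e] d0 by simp
    qed
    have "e * 1 \<le> k" using s0 unfolding k' by (intro mult_le_mono2) simp
    then have "3 \<le> k" using e'(2) d2 by simp
    \<comment> \<open>Here \<open>k = e * s\<close> with \<open>e >= 3\<close>, so
      \<open>k = 4\<close> leaves only \<open>s = 1\<close>.\<close>
    moreover have "v \<ge> 2" if "k = 4"
    proof (rule v2, rule ccontr)
      assume "s \<noteq> 1"
      then have "3 * 2 \<le> e * s" using s0 e'(2) d2 by (intro mult_le_mono) auto
      then show False using that k' by simp
    qed
    moreover have "2 * ?n * w e \<le> d * (d * w d)"
    proof -
      have "2 * k * u * scaled_binomial u v (d * s) \<le> d * scaled_binomial u v k"
        unfolding k' by (rule scaled_binomial_near[OF u v d2 e'(2) s0 v2])
      from mult_le_mono2[OF this, of d] show ?thesis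
        unfolding wd uv(1) we by (simp add: gk mult_ac)
    qed
    ultimately show ?thesis by blast
  qed
  have far: "0 < g div e" "2 * (g div e) \<le> k" if e: "e \<in> R1" for e
  proof -
    have e': "e dvd g" "2 * d \<le> e" using e by (auto simp: R1_def R_def)
    obtain k' where k': "g = e * k'" using e'(1) by auto
    have "k' > 0" "e > 0" using g k' by (auto intro: Nat.gr0I)
    moreover have "2 * d * k' \<le> d * k" using mult_le_mono1[OF e'(2), of k'] k' gk by simp
    then have "2 * k' \<le> k" using d0 by simp
    ultimately show "0 < g div e" "2 * (g div e) \<le> k" using k' by simp_all
  qed
  have halving: "?n * w e \<le> d * w d" if e: "e \<in> R1" for e
  proof -
    have "k * u * scaled_binomial u v (g div e) \<le> scaled_binomial u v k"
      by (rule scaled_binomial_halving[OF u v far(2,1)[OF e]])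
    from mult_le_mono2[OF this, of d] show ?thesis by (simp add: w_def wd uv(1) gk mult_ac)
  qed
  have halving_strong: "2 * ?n * w e \<le> d * w d" if e: "e \<in> R1" and ne: "R2 \<noteq> {}" for e
  proof -
    have "2 * k * u * scaled_binomial u v (g div e) \<le> scaled_binomial u v k"
      by (rule scaled_binomial_halving_strong[OF u v far(2)[OF e]]) (use near ne in auto)
    from mult_le_mono2[OF this, of d] show ?thesis by (simp add: w_def wd uv(1) gk mult_ac)
  qed
  \<comment> \<open>The identity has order 1 and is not counted; this makes the final estimate
    strict.\<close>
  have count1: "(\<Sum>e\<in>R1. f e) < ?n"
  proof -
    have "(\<Sum>e\<in>R1. f e) = card {x \<in> carrier K. K.ord x \<in> R1}"
      unfolding f_def by (rule K.sum_num_elems_of_order[OF K(2) finR12(1)])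
    also have "\<dots> < card (carrier K)"
    proof (rule psubset_card_mono[OF K(2)])
      have "1 \<notin> R1" using d0 by (auto simp: R1_def)
      then have "\<one>\<^bsub>K\<^esub> \<notin> {x \<in> carrier K. K.ord x \<in> R1}" by simp
      then show "{x \<in> carrier K. K.ord x \<in> R1} \<subset> carrier K" by blast
    qed
    finally show ?thesis by (simp add: order_def)
  qed
  have count2: "(\<Sum>e\<in>R2. f e) * d \<le> ?n"
  proof -
    have "(\<Sum>e\<in>R2. f e) = card {x \<in> carrier K. K.ord x \<in> R2}"
      unfolding f_def by (rule K.sum_num_elems_of_order[OF K(2) finR12(2)])
    then show ?thesis
      using K.card_coprime_order_le[OF K(2) p(1) dK, of "{x \<in> carrier K. K.ord x \<in> R2}"] not_p j(1)
      by auto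
  qed
  \<comment> \<open>If \<open>R2\<close> is empty, \<open>R1\<close> may use the whole of
    \<open>d * w d\<close>; otherwise each of \<open>R1\<close> and \<open>R2\<close> is charged at
    most half of it, the share of \<open>R1\<close> strictly.\<close>
  have tail: "(\<Sum>e\<in>R. f e * w e) < d * w d"
  proof (cases "R2 = {}")
    case True
    have "?n * (\<Sum>e\<in>R. f e * w e) = (\<Sum>e\<in>R1. f e * (?n * w e))"
      using R(1) True by (simp add: sum_distrib_left mult_ac)
    also have "\<dots> \<le> (\<Sum>e\<in>R1. f e * (d * w d))" by (intro sum_mono mult_le_mono2 halving)
    also have "\<dots> = (\<Sum>e\<in>R1. f e) * (d * w d)" by (simp only: sum_distrib_right)
    also have "\<dots> < ?n * (d * w d)" using count1 d0 wd0 by (intro mult_less_mono1) auto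
    finally show ?thesis by simp
  next
    case False
    have "2 * ?n * (\<Sum>e\<in>R. f e * w e) = (\<Sum>e\<in>R1. f e * (2 * ?n * w e)) + (\<Sum>e\<in>R2. f e * (2 * ?n * w e))"
      unfolding R(1) using finR12 R(2) by (simp add: sum.union_disjoint sum_distrib_left mult_ac distrib_left)
    also have "\<dots> \<le> (\<Sum>e\<in>R1. f e * (d * w d)) + (\<Sum>e\<in>R2. f e * (d * (d * w d)))"
      using near by (intro add_mono sum_mono mult_le_mono2 halving_strong False) auto
    also have "\<dots> = (\<Sum>e\<in>R1. f e) * (d * w d) + (\<Sum>e\<in>R2. f e) * d * (d * w d)"
      by (simp only: sum_distrib_right mult.assoc)
    also have "\<dots> < ?n * (d * w d) + ?n * (d * w d)"
      using count1 count2 d0 wd0 by (intro add_less_le_mono mult_less_mono1 mult_le_mono1) auto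
    finally have "2 * (?n * (\<Sum>e\<in>R. f e * w e)) < 2 * (?n * (d * w d))"
      by (simp only: mult_2 distrib_right)
    then show ?thesis by simp
  qed
  have "(\<Sum>e | e dvd g. f e * w e) = f d * w d + (\<Sum>e\<in>{e. e dvd g} - {d}. f e * w e)"
    using finD dg by (subst sum.remove[of _ d]) auto
  also have "(\<Sum>e\<in>{e. e dvd g} - {d}. f e * w e) \<le>
      (\<Sum>e\<in>{e. e dvd g} - {d}. f' e * w e + (if e \<in> R then f e * w e else 0))"
  proof (rule sum_mono)
    fix e assume "e \<in> {e. e dvd g} - {d}"
    then have "e \<in> R \<or> f e = f' e" using min'[of e] by (force simp: R_def)
    then show "f e * w e \<le> f' e * w e + (if e \<in> R then f e * w e else 0)" by auto
  qed
  also have "\<dots> = (\<Sum>e\<in>{e. e dvd g} - {d}. f' e * w e) + (\<Sum>e\<in>R. f e * w e)"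
  proof -
    have "({e. e dvd g} - {d}) \<inter> R = R" by (auto simp: R_def)
    then show ?thesis using finD by (simp add: sum.distrib sum.inter_restrict[symmetric])
  qed
  finally have "(\<Sum>e | e dvd g. f e * w e) <
      f d * w d + ((\<Sum>e\<in>{e. e dvd g} - {d}. f' e * w e) + d * w d)"
    using tail by linarith
  also have "\<dots> = (f d + d) * w d + (\<Sum>e\<in>{e. e dvd g} - {d}. f' e * w e)"
    by (simp add: distrib_right)
  also have "\<dots> \<le> f' d * w d + (\<Sum>e\<in>{e. e dvd g} - {d}. f' e * w e)"
    using gap by (intro add_mono mult_le_mono1) auto
  also have "\<dots> = (\<Sum>e | e dvd g. f' e * w e)"
    using finD dg by (subst (2) sum.remove[of _ d]) auto
  finally show ?thesis by (simp add: sums f_def f'_def)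
qed

theorem theorem1p2:
  fixes G :: "('a, 'm) monoid_scheme" and H :: "('b, 'n) monoid_scheme"
  assumes "comm_group G" and "finite (carrier G)"
    and "comm_group H" and "finite (carrier H)"
  shows "cfun.dim (invariant_polys_degree G (regular_space G) (regular_rep G) (order H)) =
         cfun.dim (invariant_polys_degree H (regular_space H) (regular_rep H) (order G))
     \<longleftrightarrow> (\<forall>d::nat. d > 0 \<and> d dvd gcd (order G) (order H) \<longrightarrow>
            num_elems_of_order G d = num_elems_of_order H d)"
proof -
  interpret G: comm_group G by fact
  interpret H: comm_group H by fact
  let ?D = "cfun.dim (invariant_polys_degree G (regular_space G) (regular_rep G) (order H))"
  let ?E = "cfun.dim (invariant_polys_degree H (regular_space H) (regular_rep H) (order G))"
  let ?sG = "order_weighted_sum G (order G) (order H)" and ?sH = "order_weighted_sum H (order G) (order H)"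
  have pos: "order G > 0" "order H > 0"
    using assms G.order_gt_0_iff_finite H.order_gt_0_iff_finite by auto
  have "(order G + order H) * ?D = ?sG"
    by (rule G.dim_invariant_polys_degree[OF assms(2) pos(2)])
  moreover have "(order G + order H) * ?E = ?sH"
    using H.dim_invariant_polys_degree[OF assms(4) pos(1)]
    by (simp add: add.commute order_weighted_sum_commute[of H "order G"])
  ultimately have "?D = ?E \<longleftrightarrow> ?sG = ?sH"
    using pos by (metis add_gr_0 mult_left_cancel less_irrefl)
  also have "\<dots> \<longleftrightarrow> (\<forall>d::nat. d > 0 \<and> d dvd gcd (order G) (order H) \<longrightarrow>
            num_elems_of_order G d = num_elems_of_order H d)" (is "_ \<longleftrightarrow> ?same")
  proof
    assume eq: "?sG = ?sH"
    show ?same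
    proof (rule ccontr)
      let ?bad = "\<lambda>d. d dvd gcd (order G) (order H) \<and> num_elems_of_order G d \<noteq> num_elems_of_order H d"
      assume "\<not> ?same"
      then have ex: "\<exists>d. ?bad d" by blast
      define d where "d = (LEAST d. ?bad d)"
      have d: "?bad d" unfolding d_def by (rule LeastI_ex[OF ex])
      have min: "num_elems_of_order G e = num_elems_of_order H e"
        if "e dvd gcd (order G) (order H)" "e < d" for e
        using not_less_Least[of e ?bad] that unfolding d_def by blast
      consider "num_elems_of_order G d < num_elems_of_order H d"
        | "num_elems_of_order H d < num_elems_of_order G d" using d by linarith
      then show False
      proof cases
        case 1
        have "?sG < ?sH"
          by (rule order_weighted_sum_less[OF assms, where d = d]) (use d min 1 in auto)
        then show False using eq by simp
      next
        case 2
        \<comment> \<open>With the roles of the groups exchanged, \<open>n\<close> and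
          \<open>h\<close> also trade places; the symmetry of the weights undoes this.\<close>
        have "order_weighted_sum H (order H) (order G) < order_weighted_sum G (order H) (order G)"
          by (rule order_weighted_sum_less[OF assms(3,4,1,2), where d = d])
            (use d min 2 in \<open>auto simp: gcd.commute\<close>)
        then show False using eq by (simp add: order_weighted_sum_commute)
      qed
    qed
  next
    assume same: ?same
    show "?sG = ?sH"
      unfolding order_weighted_sum_def
    proof (intro sum.cong refl)
      fix d assume d: "d \<in> {d. d dvd gcd (order G) (order H)}"
      then have "d > 0" using pos by (auto intro: Nat.gr0I)
      then show "num_elems_of_order G d * ((order G + order H) div d choose (order G div d)) =
          num_elems_of_order H d * ((order G + order H) div d choose (order G div d))"
        using same d by simp
    qed
  qed
  finally show ?thesis .
qed

end
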